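(* Let $E$ be a complex Banach space and let $L$ be a complex solvable Lie algebra of finite dimension $n$ acting on $E$ as right continuous linear operators. Let $(L_i)_{0\le i\le n}$ be a Jordan--Hölder sequence of $L$ and let $\{x_i\}_{1\le i\le n}$ be a basis of $L$ associated to this sequence. Then, in coordinates with respect to the basis of $L^*$ dual to $\{x_i\}_{1\le i\le n}$, $$\{(f(x_1),\dots,f(x_n)) : f\in Sp(L,E)\}\subseteq \prod_{j=1}^n Sp(\overline{x}_j, E\otimes\wedge L_{j-1}),$$ where $\overline{x}_j = x_j\otimes 1-1\otimes\theta(x_j)$ acting on $E\otimes\wedge L_{j-1}$.
   Context: **Right action.** $\mathcal{L}(E)$ is the algebra of bounded linear operators on $E$. "$L$ acts on $E$ as right continuous linear operators" means that $L$ is a Lie subalgebra of $\mathcal{L}(E)$ with the opposite product. That is, $L$ is a complex linear subspace of $\mathcal{L}(E)$ closed under commutators, with bracket $[x,y]=yx-xy$, where juxtaposition on the right-hand side is composition of operators. For $e\in E$ and $x\in L$ write $ex=x(e)$, so that $e[x,y]=(ex)y-(ey)x$. **Joint spectrum.** Let $L^2$ be the linear span of $\{[x,y]:x,y\in L\}$. A character of $L$ is an $f\in L^*$ with $f(L^2)=0$. Given a character $f$, consider the chain complex $(E\otimes\wedge L,d(f))$, where $\wedge L$ is the exterior algebra of $L$. Writing $e(x_1\wedge\dots\wedge x_p)$ for $e\otimes (x_1\wedge\dots\wedge x_p)$, the maps $d_{p-1}(f): E\otimes\wedge^pL\to E\otimes\wedge^{p-1}L$ for $1\le p\le n$ are given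 by $$d_{p-1}(f)\,e(x_1\wedge\dots\wedge x_p)=\sum_{k=1}^p(-1)^{k+1}\big(e(x_k-f(x_k))\big)(x_1\wedge\dots\wedge\hat{x_k}\wedge\dots\wedge x_p)+\sum_{1\le k<l\le p}(-1)^{k+l}e([x_k,x_l]\wedge x_1\wedge\dots\wedge\hat{x_k}\wedge\dots\wedge\hat{x_l}\wedge\dots\wedge x_p),$$ where a hat means deletion and $e(x_k-f(x_k))=x_k(e)-f(x_k)e$; and $d_{p-1}(f)=0$ for $p\le 0$ or $p>n$. Let $H_*(E\otimes\wedge L,d(f))$ be its homology. The joint spectrum of $L$ on $E$ is $$Sp(L,E)=\{f\in L^*: f(L^2)=0,\ H_*(E\otimes\wedge L,d(f))\neq 0\}.$$ **Jordan--Hölder sequences and bases.** A Jordan--Hölder sequence of $L$ is an increasing sequence of ideals $\{0\}=L_0\subseteq L_1\subseteq\dots\subseteq L_n=L$ with $\dim L_i=i$ for all $i$, and such that $L_k=L^2$ for some $0\le k\le n$. A basis $\{x_i\}_{1\le i\le n}$ of $L$ is associated to the sequence (a Jordan--Hölder basis) if $\{x_1,\dots,x_i\}$ is a basis of $L_i$ for every $i$. **The operators $\overline{x}_j$.** For $x\in L$, $\theta(x)$ is the derivation of $\wedge L$ extending $\mathrm{ad}(x)(y)=[x,y]$: $$\theta(x)(y_1\wedge\dots\wedge y_p)=\sum_{i=1}^p y_1\wedge\dots\wedge[x,y_i]\wedge\dots\wedge y_p,$$ with $\theta(x)=0$ on $\wedge^0L=\mathbb{C}$. Since $L_{j-1}$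 is an ideal, $\theta(x_j)$ maps $\wedge L_{j-1}$ to itself. The operator $\overline{x}_j=x_j\otimes1-1\otimes\theta(x_j)$ acts on $E\otimes\wedge L_{j-1}$ by $e\otimes\omega\mapsto x_j(e)\otimes\omega-e\otimes\theta(x_j)\omega$. Here $\wedge L_0=\mathbb{C}$, and $E\otimes\wedge L_{j-1}$ is a Banach space, being a finite direct sum of copies of $E$. $Sp(\overline{x}_j,E\otimes\wedge L_{j-1})\subseteq\mathbb{C}$ is the usual spectrum of this bounded operator. *)

theory Defs
  imports "HOL-Analysis.Analysis" "HOL-Library.Poly_Mapping" "HOL-Library.Set_Algebras"
begin

section \<open>Complex vector spaces and complex Banach spaces\<close>

class complex_vector = ab_group_add +
  fixes scaleC :: "complex \<Rightarrow> 'a \<Rightarrow> 'a"  (infixr \<open>*\<^sub>C\<close> 75)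
  assumes scaleC_add_right: "a *\<^sub>C (x + y) = a *\<^sub>C x + a *\<^sub>C y"
    and scaleC_add_left: "(a + b) *\<^sub>C x = a *\<^sub>C x + b *\<^sub>C x"
    and scaleC_scaleC: "a *\<^sub>C b *\<^sub>C x = (a * b) *\<^sub>C x"
    and scaleC_one: "1 *\<^sub>C x = x"

global_interpretation complex_vector: vector_space "scaleC :: complex \<Rightarrow> 'a \<Rightarrow> 'a::complex_vector"
  by unfold_locales (rule scaleC_add_right scaleC_add_left scaleC_scaleC scaleC_one)+

abbreviation csubspace :: "'a::complex_vector set \<Rightarrow> bool"
  where "csubspace \<equiv> complex_vector.subspace"

abbreviation cspan :: "'a::complex_vector set \<Rightarrow> 'a set"
  where "cspan \<equiv> complex_vector.span"

abbreviation cindependent :: "'a::complex_vector set \<Rightarrow> bool"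
  where "cindependent \<equiv> complex_vector.independent"

abbreviation cdim :: "'a::complex_vector set \<Rightarrow> nat"
  where "cdim \<equiv> complex_vector.dim"

class complex_normed_vector = complex_vector + real_normed_vector +
  assumes scaleR_scaleC: "r *\<^sub>R x = complex_of_real r *\<^sub>C x"
    and norm_scaleC: "norm (a *\<^sub>C x) = cmod a * norm x"

class complex_banach = complex_normed_vector + banach

instantiation complex :: complex_banach
begin

definition scaleC_complex :: "complex \<Rightarrow> complex \<Rightarrow> complex"
  where "scaleC_complex = (*)"

instance
  by intro_classes (simp_all add: scaleC_complex_def algebra_simps scaleR_conv_of_real norm_mult)

end

lemma bounded_linear_scaleC: "bounded_linear (\<lambda>x::'a::complex_normed_vector. a *\<^sub>C x)"
proof (rule bounded_linear_intro)
  show "a *\<^sub>C (x + y) = a *\<^sub>C x + a *\<^sub>C y" for x y :: 'a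
    by (rule scaleC_add_right)
  show "a *\<^sub>C (r *\<^sub>R x) = r *\<^sub>R (a *\<^sub>C x)" for r and x :: 'a
    by (simp add: scaleR_scaleC scaleC_scaleC mult.commute)
  show "norm (a *\<^sub>C x) \<le> norm x * cmod a" for x :: 'a
    by (simp add: norm_scaleC mult.commute)
qed

instantiation blinfun :: (real_normed_vector, complex_normed_vector) complex_vector
begin

lift_definition scaleC_blinfun :: "complex \<Rightarrow> 'a \<Rightarrow>\<^sub>L 'b \<Rightarrow> 'a \<Rightarrow>\<^sub>L 'b"
  is "\<lambda>a x e. a *\<^sub>C x e"
  by (rule bounded_linear_compose[OF bounded_linear_scaleC])

instance
  by (intro_classes; transfer)
    (simp_all add: scaleC_add_right scaleC_add_left scaleC_scaleC scaleC_one)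

end

instantiation poly_mapping :: (type, complex_vector) complex_vector
begin

lift_definition scaleC_poly_mapping :: "complex \<Rightarrow> ('a \<Rightarrow>\<^sub>0 'b) \<Rightarrow> 'a \<Rightarrow>\<^sub>0 'b"
  is "\<lambda>a u k. a *\<^sub>C u k"
  by (erule rev_finite_subset) auto

instance
  by (intro_classes; transfer)
    (simp_all add: scaleC_add_right scaleC_add_left scaleC_scaleC scaleC_one)

end


section \<open>Lie algebras of operators acting on the right\<close>

type_synonym 'e op = "'e \<Rightarrow>\<^sub>L 'e"

text \<open>The type \<^typ>\<open>'e op\<close> consists of the bounded \<^emph>\<open>real\<close>-linear operators; the algebra of bounded
  complex-linear operators is the following subset.\<close>

definition bounded_complex_operators :: "'e::complex_banach op set" where
  "bounded_complex_operators = {x. \<forall>a e. blinfun_apply x (a *\<^sub>C e) = a *\<^sub>C blinfun_apply x e}"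

text \<open>Commutator for the opposite product, so that e[x,y] = (ex)y - (ey)x when ex = x(e).\<close>

definition bracket :: "'e::complex_banach op \<Rightarrow> 'e op \<Rightarrow> 'e op" where
  "bracket x y = (y o\<^sub>L x) - (x o\<^sub>L y)"

definition lie_subalgebra :: "'e::complex_banach op set \<Rightarrow> bool" where
  "lie_subalgebra L \<longleftrightarrow> L \<subseteq> bounded_complex_operators \<and> csubspace L \<and>
     (\<forall>x\<in>L. \<forall>y\<in>L. bracket x y \<in> L)"

definition finite_dimensional :: "'a::complex_vector set \<Rightarrow> bool" where
  "finite_dimensional V \<longleftrightarrow> (\<exists>B. finite B \<and> cspan B = V)"

definition derived_algebra :: "'e::complex_banach op set \<Rightarrow> 'e op set" where
  "derived_algebra L = cspan {bracket x y | x y. x \<in> L \<and> y \<in> L}"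

definition lie_solvable :: "'e::complex_banach op set \<Rightarrow> bool" where
  "lie_solvable L \<longleftrightarrow> (\<exists>k. (derived_algebra ^^ k) L = {0})"

definition lie_ideal :: "'e::complex_banach op set \<Rightarrow> 'e op set \<Rightarrow> bool" where
  "lie_ideal I L \<longleftrightarrow> I \<subseteq> L \<and> csubspace I \<and> (\<forall>x\<in>L. \<forall>y\<in>I. bracket x y \<in> I)"

definition jordan_hoelder_sequence ::
    "'e::complex_banach op set \<Rightarrow> nat \<Rightarrow> (nat \<Rightarrow> 'e op set) \<Rightarrow> bool" where
  "jordan_hoelder_sequence L n Ls \<longleftrightarrow>
     Ls 0 = {0} \<and> Ls n = L \<and>
     (\<forall>i<n. Ls i \<subseteq> Ls (Suc i)) \<and>
     (\<forall>i\<le>n. lie_ideal (Ls i) L \<and> finite_dimensional (Ls i) \<and> cdim (Ls i) = i) \<and>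
     (\<exists>k\<le>n. Ls k = derived_algebra L)"

definition jordan_hoelder_basis ::
    "nat \<Rightarrow> (nat \<Rightarrow> 'e::complex_banach op set) \<Rightarrow> (nat \<Rightarrow> 'e op) \<Rightarrow> bool" where
  "jordan_hoelder_basis n Ls x \<longleftrightarrow> inj_on x {1..n} \<and>
     (\<forall>i\<le>n. cindependent (x ` {1..i}) \<and> cspan (x ` {1..i}) = Ls i)"


section \<open>The space $E \otimes \bigwedge L$\<close>

text \<open>
  The space is presented by generators and relations: the free complex vector space on the symbols
  e(y1 ... yp), with e in E and y1, ..., yp in L, modulo the subspace spanned by the relations
  expressing linearity in e, linearity in each y and the vanishing on lists with a repetition.
  Its elements are cosets of this subspace.
\<close>

type_synonym 'e formal = "('e \<times> 'e op list) \<Rightarrow>\<^sub>0 complex"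

definition symb :: "'e::complex_banach \<Rightarrow> 'e op list \<Rightarrow> 'e formal" where
  "symb e ys = Poly_Mapping.single (e, ys) 1"

definition linear_extension ::
    "('e \<times> 'e op list \<Rightarrow> 'e formal) \<Rightarrow> 'e::complex_banach formal \<Rightarrow> 'e formal" where
  "linear_extension g u = (\<Sum>k\<in>Poly_Mapping.keys u. Poly_Mapping.lookup u k *\<^sub>C g k)"

definition formal_tensors :: "'e::complex_banach op set \<Rightarrow> 'e formal set" where
  "formal_tensors L = cspan {symb e ys | e ys. set ys \<subseteq> L}"

definition formal_tensors_deg :: "'e::complex_banach op set \<Rightarrow> nat \<Rightarrow> 'e formal set" where
  "formal_tensors_deg L p = cspan {symb e ys | e ys. set ys \<subseteq> L \<and> length ys = p}"

definition tensor_relations :: "'e::complex_banach op set \<Rightarrow> 'e formal set" where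
  "tensor_relations L = cspan
     ({symb (e + e') ys - symb e ys - symb e' ys | e e' ys. set ys \<subseteq> L} \<union>
      {symb (a *\<^sub>C e) ys - a *\<^sub>C symb e ys | a e ys. set ys \<subseteq> L} \<union>
      {symb e (ys @ (y + y') # zs) - symb e (ys @ y # zs) - symb e (ys @ y' # zs) | e ys y y' zs.
         set ys \<subseteq> L \<and> y \<in> L \<and> y' \<in> L \<and> set zs \<subseteq> L} \<union>
      {symb e (ys @ (a *\<^sub>C y) # zs) - a *\<^sub>C symb e (ys @ y # zs) | e ys a y zs.
         set ys \<subseteq> L \<and> y \<in> L \<and> set zs \<subseteq> L} \<union>
      {symb e ys | e ys. set ys \<subseteq> L \<and> \<not> distinct ys})"

definition tensor_ext :: "'e::complex_banach op set \<Rightarrow> 'e formal set set" where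
  "tensor_ext L = (\<lambda>u. u +o tensor_relations L) ` formal_tensors L"

definition tensor_ext_deg :: "'e::complex_banach op set \<Rightarrow> nat \<Rightarrow> 'e formal set set" where
  "tensor_ext_deg L p = (\<lambda>u. u +o tensor_relations L) ` formal_tensors_deg L p"

text \<open>
  The map induced on cosets by a linear map T of formal tensors that preserves the relations;
  all the cosets in the union then coincide.
\<close>

definition induced_map ::
    "'e::complex_banach op set \<Rightarrow> ('e formal \<Rightarrow> 'e formal) \<Rightarrow> 'e formal set \<Rightarrow> 'e formal set" where
  "induced_map L T C = (\<Union>u\<in>C. T u +o tensor_relations L)"

text \<open>
  The projective norm of a class: the infimum of the sums of |c| |e| |y1| ... |yp| over all
  representatives. For L of finite dimension it is equivalent to the norm obtained by identifying
  the space, through a basis of L, with a finite direct sum of copies of E.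
\<close>

definition formal_norm :: "'e::complex_banach formal \<Rightarrow> real" where
  "formal_norm u = (\<Sum>(e, ys)\<in>Poly_Mapping.keys u.
     cmod (Poly_Mapping.lookup u (e, ys)) * norm e * prod_list (map norm ys))"

definition tensor_norm :: "'e::complex_banach formal set \<Rightarrow> real" where
  "tensor_norm C = Inf (formal_norm ` C)"


section \<open>The joint spectrum\<close>

text \<open>
  Positions in a list are counted from 0, which leaves the sign of the second sum unchanged and
  turns the sign of the first one into (-1)^k. The list \<^term>\<open>nths ys (- {k})\<close> is \<^term>\<open>ys\<close> with
  position \<^term>\<open>k\<close> deleted.
\<close>

definition boundary_symb ::
    "('e::complex_banach op \<Rightarrow> complex) \<Rightarrow> 'e \<times> 'e op list \<Rightarrow> 'e formal" where
  "boundary_symb f = (\<lambda>(e, ys).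
     (\<Sum>k<length ys. (-1) ^ k *\<^sub>C
        symb (blinfun_apply (ys ! k) e - f (ys ! k) *\<^sub>C e) (nths ys (- {k}))) +
     (\<Sum>l<length ys. \<Sum>k<l. (-1) ^ (k + l) *\<^sub>C
        symb e (bracket (ys ! k) (ys ! l) # nths ys (- {k, l}))))"

definition boundary ::
    "'e::complex_banach op set \<Rightarrow> ('e op \<Rightarrow> complex) \<Rightarrow> 'e formal set \<Rightarrow> 'e formal set" where
  "boundary L f = induced_map L (linear_extension (boundary_symb f))"

text \<open>The coset \<^term>\<open>tensor_relations L\<close> is the zero of the quotient. In degree 0 the boundary is
  zero because both sums are empty.\<close>

definition homology_nonzero ::
    "'e::complex_banach op set \<Rightarrow> ('e op \<Rightarrow> complex) \<Rightarrow> nat \<Rightarrow> bool" where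
  "homology_nonzero L f p \<longleftrightarrow>
     (\<exists>c\<in>tensor_ext_deg L p. boundary L f c = tensor_relations L \<and>
        c \<notin> boundary L f ` tensor_ext_deg L (Suc p))"

definition dual_space :: "'e::complex_banach op set \<Rightarrow> ('e op \<Rightarrow> complex) set" where
  "dual_space L = {f \<in> extensional L. (\<forall>x\<in>L. \<forall>y\<in>L. f (x + y) = f x + f y) \<and>
     (\<forall>a. \<forall>x\<in>L. f (a *\<^sub>C x) = a * f x)}"

definition joint_spectrum :: "'e::complex_banach op set \<Rightarrow> ('e op \<Rightarrow> complex) set" where
  "joint_spectrum L = {f \<in> dual_space L. (\<forall>z\<in>derived_algebra L. f z = 0) \<and>
     (\<exists>p. homology_nonzero L f p)}"


section \<open>The operators $\overline{x}$ and their spectra\<close>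

definition xbar_symb :: "'e::complex_banach op \<Rightarrow> 'e \<times> 'e op list \<Rightarrow> 'e formal" where
  "xbar_symb x = (\<lambda>(e, ys).
     symb (blinfun_apply x e) ys - (\<Sum>i<length ys. symb e (ys[i := bracket x (ys ! i)])))"

text \<open>The operator \<^term>\<open>xbar_minus M x lam\<close> is $\overline{x}$ minus the scalar \<^term>\<open>lam\<close>, acting on
  $E \otimes \bigwedge M$.\<close>

definition xbar_minus ::
    "'e::complex_banach op set \<Rightarrow> 'e op \<Rightarrow> complex \<Rightarrow> 'e formal set \<Rightarrow> 'e formal set" where
  "xbar_minus M x lam = induced_map M (\<lambda>u. linear_extension (xbar_symb x) u - lam *\<^sub>C u)"

text \<open>The second conjunct below says that the inverse is bounded.\<close>

definition xbar_spectrum :: "'e::complex_banach op set \<Rightarrow> 'e op \<Rightarrow> complex set" where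
  "xbar_spectrum M x = {lam. \<not> (bij_betw (xbar_minus M x lam) (tensor_ext M) (tensor_ext M) \<and>
     (\<exists>K. \<forall>c\<in>tensor_ext M. tensor_norm c \<le> K * tensor_norm (xbar_minus M x lam c)))}"

end

theory Submission
  imports Defs
begin

text \<open>
  Let \<open>M = L\<^bsub>j-1\<^esub>\<close> and \<open>N = L\<^bsub>j\<^esub> = M \<oplus> \<complex>x\<^bsub>j\<^esub>\<close>. On \<open>E \<otimes> \<Lambda>N\<close> one has
  \<open>d(x\<^bsub>j\<^esub> \<and> \<omega>) = T \<omega> - x\<^bsub>j\<^esub> \<and> d\<omega>\<close> with \<open>T\<close> the operator \<open>x\<^bsub>j\<^esub>\<close>-bar minus \<open>f(x\<^bsub>j\<^esub>)\<close>, so that the complex of \<open>N\<close>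
  is the mapping cone of the chain map \<open>T\<close> on the complex of \<open>M\<close>. It is exact as soon as the
  complex of \<open>M\<close> is exact or \<open>T\<close> is bijective. If some \<open>f(x\<^bsub>j\<^esub>)\<close> is not in the spectrum, the complex
  of \<open>L\<^bsub>j\<^esub>\<close> is therefore exact, and exactness propagates from \<open>L\<^bsub>i\<^esub>\<close> to \<open>L\<^bsub>i+1\<^esub>\<close> up to \<open>L\<close>.

  Everything happens on formal tensors modulo the relations. The splitting
  \<open>\<Lambda>N = \<Lambda>M \<oplus> x\<^bsub>j\<^esub> \<and> \<Lambda>M\<close> comes from the projection of \<open>N\<close> onto \<open>M\<close> and from the contraction with
  the coordinate functional of \<open>x\<^bsub>j\<^esub>\<close>, so no basis of the exterior algebra is needed.
\<close>

section \<open>Linear maps of formal tensors\<close>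

lemma linear_extension_superset:
  assumes "finite K" "Poly_Mapping.keys u \<subseteq> K"
  shows "linear_extension g u = (\<Sum>k\<in>K. Poly_Mapping.lookup u k *\<^sub>C g k)"
  unfolding linear_extension_def
  by (rule sum.mono_neutral_left) (use assms in \<open>auto simp: in_keys_iff\<close>)

lemma lookup_scaleC: "Poly_Mapping.lookup (a *\<^sub>C u) k = a *\<^sub>C Poly_Mapping.lookup u k"
  by transfer simp

lemma linear_extension_add [simp]:
  "linear_extension g (u + v) = linear_extension g u + linear_extension g v"
proof -
  let ?K = "Poly_Mapping.keys u \<union> Poly_Mapping.keys v"
  have "Poly_Mapping.keys (u + v) \<subseteq> ?K" by (rule Poly_Mapping.keys_add)
  then show ?thesis
    by (simp add: linear_extension_superset[of ?K] lookup_add complex_vector.scale_left_distrib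
        sum.distrib)
qed

lemma linear_extension_scale [simp]:
  "linear_extension g (a *\<^sub>C u) = a *\<^sub>C linear_extension g u"
proof -
  have "Poly_Mapping.keys (a *\<^sub>C u) \<subseteq> Poly_Mapping.keys u"
    by (auto simp: in_keys_iff lookup_scaleC)
  then show ?thesis
    by (simp add: linear_extension_superset[of "Poly_Mapping.keys u"] lookup_scaleC
        complex_vector.scale_sum_right scaleC_complex_def)
qed

lemma linear_extension_zero [simp]: "linear_extension g 0 = 0"
  by (simp add: linear_extension_def)

lemma linear_extension_uminus [simp]: "linear_extension g (- u) = - linear_extension g u"
  using linear_extension_scale[of g "-1" u] by simp

lemma linear_extension_diff [simp]:
  "linear_extension g (u - v) = linear_extension g u - linear_extension g v"
  using linear_extension_add[of g u "- v"] by simp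

lemma linear_extension_sum [simp]:
  "linear_extension g (\<Sum>i\<in>A. h i) = (\<Sum>i\<in>A. linear_extension g (h i))"
  by (induction A rule: infinite_finite_induct) auto

lemma linear_extension_symb [simp]: "linear_extension g (symb e ys) = g (e, ys)"
  by (simp add: linear_extension_def symb_def complex_vector.scale_one)

section \<open>Left exterior multiplication and the span of the symbols with entries in
  \<open>N\<close>\<close>

definition wedge :: "'e::complex_banach op \<Rightarrow> 'e formal \<Rightarrow> 'e formal" where
  "wedge z = linear_extension (\<lambda>(e, ys). symb e (z # ys))"

lemma wedge_linear [simp]:
  "wedge z (u + v) = wedge z u + wedge z v"
  "wedge z (u - v) = wedge z u - wedge z v"
  "wedge z (a *\<^sub>C u) = a *\<^sub>C wedge z u"
  "wedge z (- u) = - wedge z u"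
  "wedge z 0 = 0"
  "wedge z (sum h A) = (\<Sum>i\<in>A. wedge z (h i))"
  by (simp_all add: wedge_def)

lemma wedge_symb [simp]: "wedge z (symb e ys) = symb e (z # ys)"
  by (simp add: wedge_def)

lemma formal_tensors_subspace: "csubspace (formal_tensors N)"
  by (simp add: formal_tensors_def complex_vector.subspace_span)

lemmas formal_tensors_closed [simp] =
  complex_vector.subspace_0[OF formal_tensors_subspace]
  complex_vector.subspace_add[OF formal_tensors_subspace]
  complex_vector.subspace_diff[OF formal_tensors_subspace]
  complex_vector.subspace_neg[OF formal_tensors_subspace]
  complex_vector.subspace_scale[OF formal_tensors_subspace]
  complex_vector.subspace_sum[OF formal_tensors_subspace]

lemma symb_in_formal_tensors [simp]: "set ys \<subseteq> N \<Longrightarrow> symb e ys \<in> formal_tensors N"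
  unfolding formal_tensors_def by (rule complex_vector.span_base) blast

lemma formal_tensors_symb_induct [consumes 1, case_names zero add scale symb]:
  assumes "u \<in> formal_tensors N"
    and "P 0" "\<And>u v. P u \<Longrightarrow> P v \<Longrightarrow> P (u + v)" "\<And>a u. P u \<Longrightarrow> P (a *\<^sub>C u)"
    and "\<And>e ys. set ys \<subseteq> N \<Longrightarrow> P (symb e ys)"
  shows "P u"
  using assms(1) unfolding formal_tensors_def
  by (rule complex_vector.span_induct)
     (use assms in \<open>auto intro!: complex_vector.subspaceI\<close>)

lemma linear_extension_in_formal_tensors:
  assumes "\<And>e ys. set ys \<subseteq> N \<Longrightarrow> g (e, ys) \<in> formal_tensors N'" "u \<in> formal_tensors N"
  shows "linear_extension g u \<in> formal_tensors N'"
  using assms(2) by (induction rule: formal_tensors_symb_induct) (auto intro: assms(1))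

lemma wedge_in_formal_tensors [simp]:
  "u \<in> formal_tensors N \<Longrightarrow> z \<in> N \<Longrightarrow> wedge z u \<in> formal_tensors N"
  unfolding wedge_def by (erule linear_extension_in_formal_tensors[rotated]) auto

text \<open>Every symbol arises from one with an empty list by repeated \<open>wedge\<close>. An
  operator with a known commutation rule with \<open>wedge\<close> can thus be handled without
  computing with positions in lists.\<close>

lemma formal_tensors_induct [consumes 1, case_names zero add scale symb wedge]:
  assumes "u \<in> formal_tensors N"
    and "P 0" "\<And>u v. P u \<Longrightarrow> P v \<Longrightarrow> P (u + v)" "\<And>a u. P u \<Longrightarrow> P (a *\<^sub>C u)"
    and "\<And>e. P (symb e [])"
    and step: "\<And>z u. z \<in> N \<Longrightarrow> u \<in> formal_tensors N \<Longrightarrow> P u \<Longrightarrow> P (wedge z u)"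
  shows "P u"
  using assms(1)
proof (induction rule: formal_tensors_symb_induct)
  case (symb e ys)
  then show ?case
  proof (induction ys)
    case (Cons z ys)
    then show ?case using step[of z "symb e ys"] by simp
  qed (rule assms)
qed (use assms in auto)

lemma formal_tensors_mono: "M \<subseteq> N \<Longrightarrow> formal_tensors M \<subseteq> formal_tensors N"
  unfolding formal_tensors_def by (rule complex_vector.span_mono) blast

text \<open>The symbols span the whole free space. Identities that hold before any relation is
  divided out, such as \<open>act_wedge\<close>, can therefore be proved by induction without a
  membership hypothesis.\<close>

lemma formal_tensors_UNIV: "u \<in> formal_tensors UNIV"
proof -
  have "u = linear_extension (\<lambda>(e, ys). symb e ys) u"
  proof (rule poly_mapping_eqI)
    fix k
    have "Poly_Mapping.lookup (\<Sum>i\<in>A. h i) k = (\<Sum>i\<in>A. Poly_Mapping.lookup (h i) k)"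
      for A and h :: "'a \<times> 'a op list \<Rightarrow> 'a formal"
      by (rule lookup_sum)
    then show "Poly_Mapping.lookup u k =
        Poly_Mapping.lookup (linear_extension (\<lambda>(e, ys). symb e ys) u) k"
      by (auto simp: linear_extension_def symb_def lookup_scaleC lookup_single when_def
          scaleC_complex_def case_prod_unfold in_keys_iff if_distrib cong: if_cong)
  qed
  also have "\<dots> \<in> formal_tensors UNIV"
    unfolding linear_extension_def by (intro formal_tensors_closed) auto
  finally show ?thesis .
qed


section \<open>The relations\<close>

lemma relations_subspace: "csubspace (tensor_relations N)"
  by (simp add: tensor_relations_def complex_vector.subspace_span)

lemmas relations_closed [simp] =
  complex_vector.subspace_0[OF relations_subspace]
  complex_vector.subspace_add[OF relations_subspace]
  complex_vector.subspace_diff[OF relations_subspace]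
  complex_vector.subspace_neg[OF relations_subspace]
  complex_vector.subspace_scale[OF relations_subspace]
  complex_vector.subspace_sum[OF relations_subspace]

lemma relations_mono: "M \<subseteq> N \<Longrightarrow> tensor_relations M \<subseteq> tensor_relations N"
  unfolding tensor_relations_def
  by (rule complex_vector.span_mono) (intro Un_mono; blast)

lemma relation_add:
  "set ys \<subseteq> N \<Longrightarrow> symb (e + e') ys - symb e ys - symb e' ys \<in> tensor_relations N"
  and relation_scale:
  "set ys \<subseteq> N \<Longrightarrow> symb (a *\<^sub>C e) ys - a *\<^sub>C symb e ys \<in> tensor_relations N"
  and relation_slot_add:
  "set ys \<subseteq> N \<Longrightarrow> y \<in> N \<Longrightarrow> y' \<in> N \<Longrightarrow> set zs \<subseteq> N \<Longrightarrow>
    symb e (ys @ (y + y') # zs) - symb e (ys @ y # zs) - symb e (ys @ y' # zs)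
      \<in> tensor_relations N"
  and relation_slot_scale:
  "set ys \<subseteq> N \<Longrightarrow> y \<in> N \<Longrightarrow> set zs \<subseteq> N \<Longrightarrow>
    symb e (ys @ (a *\<^sub>C y) # zs) - a *\<^sub>C symb e (ys @ y # zs) \<in> tensor_relations N"
  and relation_repeat:
  "set ys \<subseteq> N \<Longrightarrow> \<not> distinct ys \<Longrightarrow> symb e ys \<in> tensor_relations N"
  unfolding tensor_relations_def by (rule complex_vector.span_base; blast)+

lemma relation_diff:
  assumes "set ys \<subseteq> N"
  shows "symb (e - e') ys - symb e ys + symb e' ys \<in> tensor_relations N"
proof -
  have "symb (e - e') ys - symb e ys + symb e' ys
      = - (symb ((e - e') + e') ys - symb (e - e') ys - symb e' ys)" by simp
  then show ?thesis using relation_add[OF assms] by (metis relations_closed(4))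
qed

lemma relation_wedge_add:
  assumes "u \<in> formal_tensors N" "y \<in> N" "y' \<in> N"
  shows "wedge (y + y') u - wedge y u - wedge y' u \<in> tensor_relations N"
  using assms(1)
proof (induction rule: formal_tensors_symb_induct)
  case (add u v)
  then show ?case using relations_closed(2)[OF add] by (simp add: algebra_simps)
next
  case (scale a u)
  then show ?case using relations_closed(5)[OF scale, of a]
    by (simp add: complex_vector.scale_right_diff_distrib)
next
  case (symb e ys)
  then show ?case using relation_slot_add[of "[]" N y y' ys e] assms by simp
qed auto

lemma relation_wedge_scale:
  assumes "u \<in> formal_tensors N" "y \<in> N"
  shows "wedge (a *\<^sub>C y) u - a *\<^sub>C wedge y u \<in> tensor_relations N"
  using assms(1)
proof (induction rule: formal_tensors_symb_induct)
  case (add u v)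
  then show ?case using relations_closed(2)[OF add]
    by (simp add: algebra_simps complex_vector.scale_right_distrib)
next
  case (scale b u)
  then show ?case using relations_closed(5)[OF scale, of b]
    by (simp add: complex_vector.scale_right_diff_distrib mult.commute)
next
  case (symb e ys)
  then show ?case using relation_slot_scale[of "[]" N y ys e] assms by simp
qed auto

lemma relation_wedge_zero:
  assumes "u \<in> formal_tensors N" "0 \<in> N"
  shows "wedge 0 u \<in> tensor_relations N"
  using relation_wedge_scale[OF assms, of 0] by simp

lemma relation_wedge_self:
  assumes "u \<in> formal_tensors N" "y \<in> N"
  shows "wedge y (wedge y u) \<in> tensor_relations N"
  using assms(1)
  by (induction rule: formal_tensors_symb_induct) (use assms in \<open>auto intro!: relation_repeat\<close>)

text \<open>The relations form the least subspace that contains the four families of relations at the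
  head of a list and is stable under \<^const>\<open>wedge\<close>: a repetition is brought to the head by
  transpositions.\<close>

lemma relations_induct_aux:
  assumes "u \<in> tensor_relations N" and N: "csubspace N"
    and S: "csubspace S"
    and add: "\<And>e e'. symb (e + e') [] - symb e [] - symb e' [] \<in> S"
    and scale: "\<And>a e. symb (a *\<^sub>C e) [] - a *\<^sub>C symb e [] \<in> S"
    and slot_add: "\<And>y y' u. y \<in> N \<Longrightarrow> y' \<in> N \<Longrightarrow> u \<in> formal_tensors N \<Longrightarrow>
      wedge (y + y') u - wedge y u - wedge y' u \<in> S"
    and slot_scale: "\<And>a y u. y \<in> N \<Longrightarrow> u \<in> formal_tensors N \<Longrightarrow>
      wedge (a *\<^sub>C y) u - a *\<^sub>C wedge y u \<in> S"
    and self: "\<And>y u. y \<in> N \<Longrightarrow> u \<in> formal_tensors N \<Longrightarrow> wedge y (wedge y u) \<in> S"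
    and wedge: "\<And>z u. z \<in> N \<Longrightarrow> u \<in> S \<Longrightarrow> wedge z u \<in> S"
  shows "u \<in> S"
proof -
  note S_closed = complex_vector.subspace_add[OF S] complex_vector.subspace_diff[OF S]
  have add': "symb (e + e') ys - symb e ys - symb e' ys \<in> S" if "set ys \<subseteq> N" for e e' ys
    using that
  proof (induction ys)
    case (Cons z ys)
    then show ?case using wedge[of z "symb (e + e') ys - symb e ys - symb e' ys"] by simp
  qed (rule add)
  have scale': "symb (a *\<^sub>C e) ys - a *\<^sub>C symb e ys \<in> S" if "set ys \<subseteq> N" for e a ys
    using that
  proof (induction ys)
    case (Cons z ys)
    then show ?case using wedge[of z "symb (a *\<^sub>C e) ys - a *\<^sub>C symb e ys"] by simp
  qed (rule scale)
  have slot_add': "symb e (ys @ (y + y') # zs) - symb e (ys @ y # zs) - symb e (ys @ y' # zs) \<in> S"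
    if "set ys \<subseteq> N" "y \<in> N" "y' \<in> N" "set zs \<subseteq> N" for e ys y y' zs
    using that(1)
  proof (induction ys)
    case Nil
    then show ?case using slot_add[of y y' "symb e zs"] that by simp
  next
    case (Cons z ys)
    then show ?case
      using wedge[of z "symb e (ys @ (y + y') # zs) - symb e (ys @ y # zs) - symb e (ys @ y' # zs)"]
      by simp
  qed
  have slot_scale': "symb e (ys @ (a *\<^sub>C y) # zs) - a *\<^sub>C symb e (ys @ y # zs) \<in> S"
    if "set ys \<subseteq> N" "y \<in> N" "set zs \<subseteq> N" for e ys a y zs
    using that(1)
  proof (induction ys)
    case Nil
    then show ?case using slot_scale[of y "symb e zs"] that by simp
  next
    case (Cons z ys)
    then show ?case
      using wedge[of z "symb e (ys @ (a *\<^sub>C y) # zs) - a *\<^sub>C symb e (ys @ y # zs)"]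
      by simp
  qed
  \<comment> \<open>Polarization: expanding the square of \<open>y + z\<close> leaves the two mixed
    terms, because the squares of \<open>y\<close>, \<open>z\<close> and \<open>y + z\<close> lie in
    \<open>S\<close>.\<close>
  have swap: "wedge y (wedge z u) + wedge z (wedge y u) \<in> S"
    if "y \<in> N" "z \<in> N" "u \<in> formal_tensors N" for y z u
  proof -
    have yz: "y + z \<in> N" using N that by (simp add: complex_vector.subspace_add)
    let ?a = "wedge (y + z)" and ?l = "\<lambda>u. wedge (y + z) u - wedge y u - wedge z u"
    have "wedge y (wedge z u) + wedge z (wedge y u)
        = ?a (?a u) - ?l (?a u) - wedge y (?l u) - wedge z (?l u)
          - wedge y (wedge y u) - wedge z (wedge z u)"
      by (simp add: algebra_simps)
    also have "\<dots> \<in> S"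
      using that yz by (intro S_closed self slot_add wedge) auto
    finally show ?thesis .
  qed
  \<comment> \<open>The leading \<open>y\<close> is moved to the right past each entry
    \<open>v\<close>, with a change of sign modulo \<open>S\<close>, until it meets its
    copy.\<close>
  have repeat_hd: "symb e (y # ys @ y # zs) \<in> S"
    if "y \<in> N" "set ys \<subseteq> N" "set zs \<subseteq> N" for e y ys zs
    using that(2)
  proof (induction ys)
    case Nil
    then show ?case using self[of y "symb e zs"] that by simp
  next
    case (Cons v ys)
    let ?u = "symb e (ys @ y # zs)"
    have "symb e (y # (v # ys) @ y # zs)
        = (wedge y (wedge v ?u) + wedge v (wedge y ?u)) - wedge v (symb e (y # ys @ y # zs))"
      by simp
    also have "\<dots> \<in> S"
      using that Cons by (intro S_closed(2) swap wedge) auto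
    finally show ?case .
  qed
  have repeat: "symb e ys \<in> S" if ys: "set ys \<subseteq> N" "\<not> distinct ys" for e ys
  proof -
    obtain as y bs cs where "ys = as @ [y] @ bs @ [y] @ cs"
      using not_distinct_decomp[OF ys(2)] by blast
    moreover from this ys have "symb e (as @ y # bs @ y # cs) \<in> S"
    proof (induction as arbitrary: ys)
      case Nil
      then show ?case using repeat_hd[of y bs cs e] by auto
    next
      case (Cons z as)
      have "symb e (as @ y # bs @ y # cs) \<in> S"
        using Cons.prems by (intro Cons.IH[of "as @ [y] @ bs @ [y] @ cs"]) auto
      then show ?case using wedge[of z "symb e (as @ y # bs @ y # cs)"] Cons.prems by auto
    qed
    ultimately show ?thesis by simp
  qed
  have "tensor_relations N \<subseteq> S"
    unfolding tensor_relations_def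
    by (rule complex_vector.span_minimal[OF _ S])
       (auto intro: add' scale' slot_add' slot_scale' repeat)
  then show ?thesis using assms(1) by blast
qed

text \<open>Each generator turns into a generator of the same family when one more entry is put in
  front.\<close>

lemma relation_wedge:
  assumes "u \<in> tensor_relations N" "z \<in> N"
  shows "wedge z u \<in> tensor_relations N"
proof -
  have "csubspace {u. wedge z u \<in> tensor_relations N}"
    by (rule complex_vector.subspaceI) auto
  moreover have
    "wedge z (symb e (ys @ (y + y') # zs) - symb e (ys @ y # zs) - symb e (ys @ y' # zs))
      \<in> tensor_relations N"
    if "set ys \<subseteq> N" "y \<in> N" "y' \<in> N" "set zs \<subseteq> N" for e ys y y' zs
    using relation_slot_add[of "z # ys" N y y' zs e] that assms by simp
  moreover have "wedge z (symb e (ys @ (a *\<^sub>C y) # zs) - a *\<^sub>C symb e (ys @ y # zs))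
      \<in> tensor_relations N"
    if "set ys \<subseteq> N" "y \<in> N" "set zs \<subseteq> N" for e ys a y zs
    using relation_slot_scale[of "z # ys" N y zs e a] that assms by simp
  moreover have "wedge z (symb (e + e') ys - symb e ys - symb e' ys) \<in> tensor_relations N"
    if "set ys \<subseteq> N" for e e' ys
    using relation_add[of "z # ys" N e e'] that assms by simp
  moreover have "wedge z (symb (a *\<^sub>C e) ys - a *\<^sub>C symb e ys) \<in> tensor_relations N"
    if "set ys \<subseteq> N" for a e ys
    using relation_scale[of "z # ys" N a e] that assms by simp
  moreover have "wedge z (symb e ys) \<in> tensor_relations N"
    if "set ys \<subseteq> N" "\<not> distinct ys" for e ys
    using relation_repeat[of "z # ys" N e] that assms by simp
  ultimately have "tensor_relations N \<subseteq> {u. wedge z u \<in> tensor_relations N}"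
    by (subst (1) tensor_relations_def, intro complex_vector.span_minimal)
       (auto simp del: wedge_symb wedge_linear)
  then show ?thesis using assms by blast
qed

text \<open>A repetition deep inside a list needs no case of its own, since it is covered by
  \<open>self\<close> and \<open>wedge\<close>. Membership in the relations is carried along, so
  that it is available in the case \<open>wedge\<close>.\<close>

lemma relations_induct [consumes 2, case_names zero sum scale e_add e_scale slot_add slot_scale self wedge]:
  assumes "u \<in> tensor_relations N" and N: "csubspace N"
    and "P 0" "\<And>u v. P u \<Longrightarrow> P v \<Longrightarrow> P (u + v)" "\<And>a u. P u \<Longrightarrow> P (a *\<^sub>C u)"
    and "\<And>e e'. P (symb (e + e') [] - symb e [] - symb e' [])"
    and "\<And>a e. P (symb (a *\<^sub>C e) [] - a *\<^sub>C symb e [])"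
    and "\<And>y y' u. y \<in> N \<Longrightarrow> y' \<in> N \<Longrightarrow> u \<in> formal_tensors N \<Longrightarrow>
      P (wedge (y + y') u - wedge y u - wedge y' u)"
    and "\<And>a y u. y \<in> N \<Longrightarrow> u \<in> formal_tensors N \<Longrightarrow>
      P (wedge (a *\<^sub>C y) u - a *\<^sub>C wedge y u)"
    and "\<And>y u. y \<in> N \<Longrightarrow> u \<in> formal_tensors N \<Longrightarrow> P (wedge y (wedge y u))"
    and "\<And>z u. z \<in> N \<Longrightarrow> u \<in> tensor_relations N \<Longrightarrow> P u \<Longrightarrow> P (wedge z u)"
  shows "P u"
proof -
  have "u \<in> {u. u \<in> tensor_relations N \<and> P u}"
    using assms(1) N
  proof (rule relations_induct_aux)
    show "csubspace {u. u \<in> tensor_relations N \<and> P u}"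
      by (rule complex_vector.subspaceI) (use assms in auto)
  qed (use assms in \<open>auto intro: relation_add relation_scale relation_wedge_add
      relation_wedge_scale relation_wedge_self relation_wedge\<close>)
  then show ?thesis by blast
qed


lemma relation_wedge_swap:
  assumes "csubspace N" "y \<in> N" "z \<in> N" "u \<in> formal_tensors N"
  shows "wedge y (wedge z u) + wedge z (wedge y u) \<in> tensor_relations N"
proof -
  have yz: "y + z \<in> N" using assms by (simp add: complex_vector.subspace_add)
  let ?a = "wedge (y + z)" and ?l = "\<lambda>u. wedge (y + z) u - wedge y u - wedge z u"
  have "wedge y (wedge z u) + wedge z (wedge y u)
      = ?a (?a u) - ?l (?a u) - wedge y (?l u) - wedge z (?l u)
        - wedge y (wedge y u) - wedge z (wedge z u)"
    by (simp add: algebra_simps)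
  also have "\<dots> \<in> tensor_relations N"
    using assms yz
    by (intro relations_closed relation_wedge_self relation_wedge_add relation_wedge) auto
  finally show ?thesis .
qed

text \<open>The entry passes \<open>l\<close> others on its way to the front, with one sign for
  each. This links the sum over positions in \<open>xbar_symb\<close> with the terms of
  \<open>boundary_symb\<close>, where the bracket stands at the head.\<close>

lemma relation_move_to_front:
  assumes N: "csubspace N" and "a \<in> N" "set ys \<subseteq> N" "l < length ys"
  shows "symb e (ys[l := a]) - (-1) ^ l *\<^sub>C symb e (a # nths ys (- {l})) \<in> tensor_relations N"
  using assms(3,4)
proof (induction ys arbitrary: l)
  case (Cons v ys)
  show ?case
  proof (cases l)
    case 0
    then show ?thesis
      by (simp add: nths_Cons complex_vector.scale_one Compl_eq nths_all)
  next
    case (Suc m)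
    let ?w = "symb e (nths ys (- {m}))"
    have w: "?w \<in> formal_tensors N"
      using Cons.prems set_nths_subset[of ys "- {m}"] by (intro symb_in_formal_tensors) auto
    have "{j. Suc j \<in> - {Suc m}} = - {m}" by auto
    then have "symb e ((v # ys)[l := a]) - (-1) ^ l *\<^sub>C symb e (a # nths (v # ys) (- {l}))
      = wedge v (symb e (ys[m := a]) - (-1) ^ m *\<^sub>C symb e (a # nths ys (- {m})))
        + (-1) ^ m *\<^sub>C (wedge v (wedge a ?w) + wedge a (wedge v ?w))"
      using Suc by (simp add: nths_Cons algebra_simps complex_vector.scale_right_distrib)
    also have "\<dots> \<in> tensor_relations N"
      using Cons Suc assms w
      by (intro relations_closed relation_wedge relation_wedge_swap Cons.IH) auto
    finally show ?thesis .
  qed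
qed auto


section \<open>Cartan calculus\<close>

text \<open>On formal tensors, this is \<open>y\<close>-bar minus the scalar \<open>f y\<close>. It
  plays the part of the Lie derivative in a Cartan calculus with \<open>wedge\<close> and
  \<open>bdry\<close>.\<close>

definition act :: "('e::complex_banach op \<Rightarrow> complex) \<Rightarrow> 'e op \<Rightarrow> 'e formal \<Rightarrow> 'e formal" where
  "act f y u = linear_extension (xbar_symb y) u - f y *\<^sub>C u"

definition bdry :: "('e::complex_banach op \<Rightarrow> complex) \<Rightarrow> 'e formal \<Rightarrow> 'e formal" where
  "bdry f = linear_extension (boundary_symb f)"

lemma act_linear [simp]:
  "act f y (u + v) = act f y u + act f y v"
  "act f y (u - v) = act f y u - act f y v"
  "act f y (a *\<^sub>C u) = a *\<^sub>C act f y u"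
  "act f y (- u) = - act f y u"
  "act f y 0 = 0"
  by (simp_all add: act_def complex_vector.scale_right_distrib
      complex_vector.scale_right_diff_distrib mult.commute)

lemma bdry_linear [simp]:
  "bdry f (u + v) = bdry f u + bdry f v"
  "bdry f (u - v) = bdry f u - bdry f v"
  "bdry f (a *\<^sub>C u) = a *\<^sub>C bdry f u"
  "bdry f (- u) = - bdry f u"
  "bdry f 0 = 0"
  by (simp_all add: bdry_def)

lemma xbar_symb_Cons:
  "xbar_symb y (e, z # ys) = wedge z (xbar_symb y (e, ys)) - symb e (bracket y z # ys)"
  by (simp add: xbar_symb_def sum.lessThan_Suc_shift algebra_simps del: sum.lessThan_Suc)

text \<open>Derivation rule for theta, with the minus sign that theta has in \<open>y\<close>-bar.
  It is an exact identity of formal tensors, so it can be used for rewriting.\<close>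

lemma act_wedge: "act f y (wedge z u) = wedge z (act f y u) - wedge (bracket y z) u"
  using formal_tensors_UNIV[of u]
proof (induction rule: formal_tensors_symb_induct)
  case (add u v)
  then show ?case by (simp add: add)
next
  case (scale a u)
  then show ?case by (simp add: scale complex_vector.scale_right_diff_distrib)
next
  case (symb e ys)
  then show ?case by (simp add: act_def xbar_symb_Cons)
qed auto

lemma act_symb_Nil: "act f y (symb e []) = symb (blinfun_apply y e) [] - f y *\<^sub>C symb e []"
  by (simp add: act_def xbar_symb_def)

lemma bdry_symb_Nil [simp]: "bdry f (symb e []) = 0"
  by (simp add: bdry_def boundary_symb_def)

section \<open>Algebra of the bracket\<close>

lemma bracket_self [simp]: "bracket y y = 0"
  by (simp add: bracket_def)

lemma bracket_add_left: "bracket (x + y) z = bracket x z + bracket y z"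
  and bracket_add_right: "bracket z (x + y) = bracket z x + bracket z y"
  by (simp_all add: bracket_def algebra_simps bounded_bilinear.add_left[OF bounded_bilinear_blinfun_compose]
      bounded_bilinear.add_right[OF bounded_bilinear_blinfun_compose])

lemma blinfun_apply_scaleC: "blinfun_apply (a *\<^sub>C y) e = a *\<^sub>C blinfun_apply y e"
  by transfer simp

text \<open>Composition is complex linear in its left factor, but in the right factor only behind a
  complex-linear operator. The condition therefore falls on \<open>z\<close>, the partner of the
  scaled argument.\<close>

lemma bracket_scale:
  assumes "z \<in> bounded_complex_operators"
  shows "bracket (a *\<^sub>C y) z = a *\<^sub>C bracket y z" "bracket z (a *\<^sub>C y) = a *\<^sub>C bracket z y"
  using assms
  by (auto intro!: blinfun_eqI simp: bracket_def blinfun_apply_scaleC bounded_complex_operators_def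
      blinfun.bilinear_simps complex_vector.scale_right_diff_distrib)

lemma jacobi: "bracket y (bracket z w) - bracket z (bracket y w) = bracket (bracket y z) w"
  by (auto intro!: blinfun_eqI simp: bracket_def blinfun.bilinear_simps)


text \<open>The conditions on \<open>f\<close> are imposed on \<open>N\<close> only, since an
  element of the dual is extensional and has no meaning outside \<open>L\<close>. One and the same
  \<open>f\<close> then serves for every ideal of the sequence.\<close>

locale lie_character =
  fixes N :: "'e::complex_banach op set" and f :: "'e op \<Rightarrow> complex"
  assumes subspace: "csubspace N"
    and complex_ops: "N \<subseteq> bounded_complex_operators"
    and bracket_closed [simp]: "\<And>y z. y \<in> N \<Longrightarrow> z \<in> N \<Longrightarrow> bracket y z \<in> N"
    and f_add: "\<And>y z. y \<in> N \<Longrightarrow> z \<in> N \<Longrightarrow> f (y + z) = f y + f z"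
    and f_scale: "\<And>a y. y \<in> N \<Longrightarrow> f (a *\<^sub>C y) = a * f y"
    and f_bracket: "\<And>y z. y \<in> N \<Longrightarrow> z \<in> N \<Longrightarrow> f (bracket y z) = 0"
begin

lemmas N_closed [simp] = complex_vector.subspace_add[OF subspace]
  complex_vector.subspace_0[OF subspace] complex_vector.subspace_scale[OF subspace]

abbreviation "R \<equiv> tensor_relations N"
abbreviation "F \<equiv> formal_tensors N"

lemma act_in_F [simp]:
  assumes "u \<in> F" "y \<in> N"
  shows "act f y u \<in> F"
  using assms
proof (induction rule: formal_tensors_induct)
  case (symb e)
  then show ?case by (simp add: act_symb_Nil)
next
  case (wedge z u)
  then show ?case by (simp add: act_wedge)
qed auto

lemma bdry_in_F [simp]: "u \<in> F \<Longrightarrow> bdry f u \<in> F"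
  unfolding bdry_def
proof (erule linear_extension_in_formal_tensors[rotated])
  fix e and ys :: "'e op list"
  assume ys: "set ys \<subseteq> N"
  have "set (nths ys A) \<subseteq> N" for A using ys set_nths_subset[of ys A] by blast
  then show "boundary_symb f (e, ys) \<in> F"
    using ys nth_mem[of _ ys] unfolding boundary_symb_def
    by (auto intro!: formal_tensors_closed symb_in_formal_tensors bracket_closed simp: subset_iff)
qed

text \<open>The operator \<open>y\<close> enters through \<open>blinfun_apply y e\<close> and
  through the entries \<open>bracket y w\<close>, and symbols are additive in either place only
  modulo the relations.\<close>

lemma act_add:
  assumes "u \<in> F" "y \<in> N" "z \<in> N"
  shows "act f (y + z) u - act f y u - act f z u \<in> R"
  using assms(1)
proof (induction rule: formal_tensors_induct)
  case (add u v)
  then show ?case using relations_closed(2)[OF add] by (simp add: algebra_simps)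
next
  case (scale a u)
  then show ?case using relations_closed(5)[OF scale, of a]
    by (simp add: complex_vector.scale_right_diff_distrib)
next
  case (symb e)
  then show ?case
    using relation_add[of "[]" N "blinfun_apply y e" "blinfun_apply z e"] assms
    by (simp add: act_symb_Nil f_add blinfun.add_left algebra_simps complex_vector.scale_left_distrib)
next
  case (wedge w u)
  have "act f (y + z) (wedge w u) - act f y (wedge w u) - act f z (wedge w u)
    = wedge w (act f (y + z) u - act f y u - act f z u)
      - (wedge (bracket y w + bracket z w) u - wedge (bracket y w) u - wedge (bracket z w) u)"
    by (simp add: act_wedge algebra_simps bracket_add_left)
  also have "\<dots> \<in> R"
    using assms wedge by (intro relations_closed relation_wedge relation_wedge_add wedge.IH) auto
  finally show ?case .
qed auto

lemma act_scale:
  assumes "u \<in> F" "y \<in> N"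
  shows "act f (a *\<^sub>C y) u - a *\<^sub>C act f y u \<in> R"
  using assms(1)
proof (induction rule: formal_tensors_induct)
  case (add u v)
  then show ?case using relations_closed(2)[OF add]
    by (simp add: algebra_simps complex_vector.scale_right_distrib)
next
  case (scale b u)
  then show ?case using relations_closed(5)[OF scale, of b]
    by (simp add: complex_vector.scale_right_diff_distrib mult.commute)
next
  case (symb e)
  then show ?case
    using relation_scale[of "[]" N a "blinfun_apply y e"] assms
    by (simp add: act_symb_Nil f_scale blinfun_apply_scaleC algebra_simps
        complex_vector.scale_right_diff_distrib)
next
  case (wedge w u)
  have w: "w \<in> bounded_complex_operators" using wedge complex_ops by blast
  have "act f (a *\<^sub>C y) (wedge w u) - a *\<^sub>C act f y (wedge w u)
    = wedge w (act f (a *\<^sub>C y) u - a *\<^sub>C act f y u)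
      - (wedge (a *\<^sub>C bracket y w) u - a *\<^sub>C wedge (bracket y w) u)"
    by (simp add: act_wedge algebra_simps bracket_scale[OF w] complex_vector.scale_right_diff_distrib)
  also have "\<dots> \<in> R"
    using assms wedge by (intro relations_closed relation_wedge relation_wedge_scale wedge.IH) auto
  finally show ?case .
qed auto

text \<open>The action descends to the quotient. On a square of \<open>y\<close>, the derivation
  rule yields two mixed terms in \<open>y\<close> and \<open>bracket w y\<close>, which cancel by
  anticommutativity.\<close>

lemma act_relations:
  assumes "u \<in> R" "w \<in> N"
  shows "act f w u \<in> R"
  using assms(1) subspace
proof (induction rule: relations_induct)
  case (e_add e e')
  have "act f w (symb (e + e') [] - symb e [] - symb e' [])
    = (symb (blinfun_apply w e + blinfun_apply w e') [] - symb (blinfun_apply w e) []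
        - symb (blinfun_apply w e') []) - f w *\<^sub>C (symb (e + e') [] - symb e [] - symb e' [])"
    by (simp add: act_symb_Nil blinfun.add_right algebra_simps
        complex_vector.scale_right_distrib complex_vector.scale_right_diff_distrib)
  also have "\<dots> \<in> R" by (intro relations_closed relation_add) auto
  finally show ?case .
next
  case (e_scale a e)
  have "blinfun_apply w (a *\<^sub>C e) = a *\<^sub>C blinfun_apply w e"
    using assms complex_ops by (auto simp: bounded_complex_operators_def)
  then have "act f w (symb (a *\<^sub>C e) [] - a *\<^sub>C symb e [])
    = (symb (a *\<^sub>C blinfun_apply w e) [] - a *\<^sub>C symb (blinfun_apply w e) [])
       - f w *\<^sub>C (symb (a *\<^sub>C e) [] - a *\<^sub>C symb e [])"
    by (simp add: act_symb_Nil algebra_simps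
        complex_vector.scale_right_distrib complex_vector.scale_right_diff_distrib)
  also have "\<dots> \<in> R" by (intro relations_closed relation_scale) auto
  finally show ?case .
next
  case (slot_add y y' u)
  have "act f w (wedge (y + y') u - wedge y u - wedge y' u)
    = (wedge (y + y') (act f w u) - wedge y (act f w u) - wedge y' (act f w u))
      - (wedge (bracket w y + bracket w y') u - wedge (bracket w y) u - wedge (bracket w y') u)"
    by (simp add: act_wedge bracket_add_right algebra_simps)
  also have "\<dots> \<in> R" using slot_add assms by (intro relations_closed relation_wedge_add) auto
  finally show ?case .
next
  case (slot_scale a y u)
  have w: "w \<in> bounded_complex_operators" using assms complex_ops by blast
  have "act f w (wedge (a *\<^sub>C y) u - a *\<^sub>C wedge y u)
    = (wedge (a *\<^sub>C y) (act f w u) - a *\<^sub>C wedge y (act f w u))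
      - (wedge (a *\<^sub>C bracket w y) u - a *\<^sub>C wedge (bracket w y) u)"
    by (simp add: act_wedge bracket_scale[OF w] algebra_simps complex_vector.scale_right_diff_distrib)
  also have "\<dots> \<in> R" using slot_scale assms by (intro relations_closed relation_wedge_scale) auto
  finally show ?case .
next
  case (self y u)
  have "act f w (wedge y (wedge y u)) = wedge y (wedge y (act f w u))
      - (wedge y (wedge (bracket w y) u) + wedge (bracket w y) (wedge y u))"
    by (simp add: act_wedge algebra_simps)
  also have "\<dots> \<in> R"
    using self assms subspace by (intro relations_closed relation_wedge_self relation_wedge_swap) auto
  finally show ?case .
next
  case (wedge z u)
  then show ?case using assms by (auto simp: act_wedge intro!: relations_closed(3) relation_wedge)
qed auto

text \<open>The operators \<open>y\<close>-bar again act on the right, which is why the bracket is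
  added. Scalars drop out of the commutator, \<open>f\<close> vanishes on
  \<open>bracket y z\<close>, and the new head entries combine by \<open>jacobi\<close>.\<close>

lemma act_commutator:
  assumes "u \<in> F" "y \<in> N" "z \<in> N"
  shows "act f y (act f z u) - act f z (act f y u) + act f (bracket y z) u \<in> R"
  using assms(1)
proof (induction rule: formal_tensors_induct)
  case (add u v)
  then show ?case using relations_closed(2)[OF add] by (simp add: algebra_simps)
next
  case (scale a u)
  then show ?case using relations_closed(5)[OF scale, of a]
    by (simp add: complex_vector.scale_right_diff_distrib complex_vector.scale_right_distrib)
next
  case (symb e)
  have br: "blinfun_apply (bracket y z) e
      = blinfun_apply z (blinfun_apply y e) - blinfun_apply y (blinfun_apply z e)"
    by (simp add: bracket_def blinfun.bilinear_simps)
  have "act f y (act f z (symb e [])) - act f z (act f y (symb e [])) + act f (bracket y z) (symb e [])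
    = symb (blinfun_apply z (blinfun_apply y e) - blinfun_apply y (blinfun_apply z e)) []
      - symb (blinfun_apply z (blinfun_apply y e)) [] + symb (blinfun_apply y (blinfun_apply z e)) []"
    using assms
    by (simp add: act_symb_Nil f_bracket br algebra_simps
        complex_vector.scale_right_diff_distrib mult.commute)
  also have "\<dots> \<in> R" by (rule relation_diff) simp
  finally show ?case .
next
  case (wedge w u)
  let ?a = "bracket y (bracket z w)" and ?b = "bracket z (bracket y w)"
    and ?c = "bracket (bracket y z) w"
  have "act f y (act f z (wedge w u)) - act f z (act f y (wedge w u))
      + act f (bracket y z) (wedge w u)
    = wedge w (act f y (act f z u) - act f z (act f y u) + act f (bracket y z) u)
      + (wedge (?b + ?c) u - wedge ?b u - wedge ?c u)"
    using jacobi[of y z w] by (simp add: act_wedge algebra_simps)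
  also have "\<dots> \<in> R"
    using assms wedge by (intro relations_closed relation_wedge relation_wedge_add wedge.IH) auto
  finally show ?case .
qed auto

text \<open>Cartan's formula. The term deleting \<open>z\<close> and those bracketing
  \<open>z\<close> with another entry make up \<open>act f z u\<close>; in the remaining terms the
  positions are shifted by one, which gives the minus sign.\<close>

lemma bdry_wedge:
  assumes "u \<in> F" "z \<in> N"
  shows "bdry f (wedge z u) - (act f z u - wedge z (bdry f u)) \<in> R"
  using assms(1)
proof (induction rule: formal_tensors_symb_induct)
  case (add u v)
  then show ?case using relations_closed(2)[OF add] by (simp add: algebra_simps)
next
  case (scale a u)
  then show ?case using relations_closed(5)[OF scale, of a]
    by (simp add: complex_vector.scale_right_diff_distrib)
next
  case (symb e ys)
  let ?n = "length ys"
  have s1: "{j. Suc j \<in> - {Suc k}} = - {k}" "{j. Suc j \<in> - {0}} = UNIV"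
    "{j. Suc j \<in> - {0, Suc k}} = - {k}" "{j. Suc j \<in> - {Suc k, Suc l}} = - {k, l}" for k l
    by auto
  have s2: "{j. j \<noteq> k} = - {k}" "{j. j \<noteq> k \<and> j \<noteq> l} = - {k, l}" for k l :: nat
    by auto
  have nt: "set (nths ys A) \<subseteq> N" for A using symb set_nths_subset[of ys A] by blast
  let ?z = "blinfun_apply z e"
  let ?s = "\<lambda>k l. symb e (bracket (ys ! k) (ys ! l) # z # nths ys (- {k, l}))
                + symb e (z # bracket (ys ! k) (ys ! l) # nths ys (- {k, l}))"
  \<comment> \<open>The difference consists of three defects: linearity in \<open>e\<close>, the
    transport of a bracket with \<open>z\<close> from position \<open>l\<close> to the head, and the
    order of \<open>z\<close> and a bracket of two other entries.\<close>
  have "bdry f (wedge z (symb e ys)) - (act f z (symb e ys) - wedge z (bdry f (symb e ys)))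
    = ((symb (?z - f z *\<^sub>C e) ys - symb ?z ys + symb (f z *\<^sub>C e) ys)
       - (symb (f z *\<^sub>C e) ys - f z *\<^sub>C symb e ys))
      + (\<Sum>l<?n. symb e (ys[l := bracket z (ys ! l)])
          - (-1) ^ l *\<^sub>C symb e (bracket z (ys ! l) # nths ys (- {l})))
      + (\<Sum>l<?n. \<Sum>k<l. (-1) ^ (k + l) *\<^sub>C ?s k l)"
    by (simp add: bdry_def boundary_symb_def act_def xbar_symb_def sum.lessThan_Suc_shift
        nths_Cons s1 s2 nths_all sum.distrib sum_subtractf sum_negf complex_vector.scale_one
        complex_vector.scale_right_distrib algebra_simps del: sum.lessThan_Suc)
  also have "\<dots> \<in> R"
  proof -
    have swap: "?s k l \<in> R" if "l < ?n" "k < l" for k l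
      using that symb assms relation_wedge_swap[OF subspace, of z "bracket (ys ! k) (ys ! l)"
          "symb e (nths ys (- {k, l}))"] nt[of "- {k, l}"]
      by (simp add: add.commute subset_iff)
    have "symb e (ys[l := bracket z (ys ! l)])
        - (-1) ^ l *\<^sub>C symb e (bracket z (ys ! l) # nths ys (- {l})) \<in> R" if "l < ?n" for l
      using that symb assms by (intro relation_move_to_front subspace bracket_closed) auto
    then show ?thesis
      using symb
      by (intro relations_closed(2)[OF relations_closed(2)[OF relations_closed(3)]]
          relations_closed(5,6) relation_diff relation_scale)
         (auto intro!: relations_closed(5) swap)
  qed
  finally show ?case .
qed auto

text \<open>\<open>bdry_wedge\<close> reduces each case to properties of \<open>act\<close>. On a
  square of \<open>y\<close>, the two terms with \<open>act f y u\<close> cancel and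
  \<open>bracket y y = 0\<close> disposes of the extra entry.\<close>

lemma bdry_relations:
  assumes "u \<in> R"
  shows "bdry f u \<in> R"
proof -
  have RF: "u \<in> F" if "u \<in> R" for u
    using that subspace by (induction rule: relations_induct) auto
  show ?thesis
    using assms subspace
  proof (induction rule: relations_induct)
    case (slot_add y y' u)
    let ?r = "\<lambda>y. bdry f (wedge y u) - (act f y u - wedge y (bdry f u))"
    have "bdry f (wedge (y + y') u - wedge y u - wedge y' u)
      = ?r (y + y') - ?r y - ?r y' + (act f (y + y') u - act f y u - act f y' u)
        - (wedge (y + y') (bdry f u) - wedge y (bdry f u) - wedge y' (bdry f u))"
      by (simp add: algebra_simps)
    also have "\<dots> \<in> R"
      using slot_add by (intro relations_closed relation_wedge_add bdry_wedge act_add) auto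
    finally show ?case .
  next
    case (slot_scale a y u)
    let ?r = "\<lambda>y. bdry f (wedge y u) - (act f y u - wedge y (bdry f u))"
    have "bdry f (wedge (a *\<^sub>C y) u - a *\<^sub>C wedge y u)
      = ?r (a *\<^sub>C y) - a *\<^sub>C ?r y + (act f (a *\<^sub>C y) u - a *\<^sub>C act f y u)
        - (wedge (a *\<^sub>C y) (bdry f u) - a *\<^sub>C wedge y (bdry f u))"
      by (simp add: algebra_simps complex_vector.scale_right_diff_distrib)
    also have "\<dots> \<in> R"
      using slot_scale by (intro relations_closed relation_wedge_scale bdry_wedge act_scale) auto
    finally show ?case .
  next
    case (self y u)
    let ?r = "\<lambda>u. bdry f (wedge y u) - (act f y u - wedge y (bdry f u))"
    have "bdry f (wedge y (wedge y u)) = ?r (wedge y u) - wedge y (?r u)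
        - wedge 0 u + wedge y (wedge y (bdry f u))"
      by (simp add: act_wedge algebra_simps)
    also have "\<dots> \<in> R"
      using self by (intro relations_closed relation_wedge bdry_wedge relation_wedge_zero
          relation_wedge_self) auto
    finally show ?case .
  next
    case (wedge z u)
    have "bdry f (wedge z u) = (bdry f (wedge z u) - (act f z u - wedge z (bdry f u)))
        + (act f z u - wedge z (bdry f u))"
      by simp
    also have "\<dots> \<in> R"
      using wedge by (intro relations_closed bdry_wedge act_relations relation_wedge RF) auto
    finally show ?case .
  qed auto
qed

text \<open>Expanding with \<open>bdry_wedge\<close> leaves the commutator of two actions, settled
  by \<open>act_commutator\<close>. This makes \<open>act f y\<close> a chain map on the
  quotient.\<close>

lemma act_bdry_commute:
  assumes "u \<in> F" "y \<in> N"
  shows "act f y (bdry f u) - bdry f (act f y u) \<in> R"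
  using assms(1)
proof (induction rule: formal_tensors_induct)
  case (add u v)
  then show ?case using relations_closed(2)[OF add] by (simp add: algebra_simps)
next
  case (scale a u)
  then show ?case using relations_closed(5)[OF scale, of a]
    by (simp add: complex_vector.scale_right_diff_distrib)
next
  case (symb e)
  then show ?case by (simp add: act_symb_Nil)
next
  case (wedge z u)
  let ?r = "\<lambda>z u. bdry f (wedge z u) - (act f z u - wedge z (bdry f u))"
  have "act f y (bdry f (wedge z u)) - bdry f (act f y (wedge z u))
    = act f y (?r z u) - ?r z (act f y u) + ?r (bracket y z) u
      + (act f y (act f z u) - act f z (act f y u) + act f (bracket y z) u)
      - wedge z (act f y (bdry f u) - bdry f (act f y u))"
    by (simp add: act_wedge algebra_simps)
  also have "\<dots> \<in> R"
    using wedge assms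
    by (intro relations_closed relation_wedge bdry_wedge act_relations act_commutator wedge.IH) auto
  finally show ?case .
qed auto

end


section \<open>Splitting off one basis vector\<close>

text \<open>Exactness in all degrees at once, with representatives in place of cosets;
  \<open>homology_zero\<close> recovers the graded statement.\<close>

definition koszul_exact :: "'e::complex_banach op set \<Rightarrow> ('e op \<Rightarrow> complex) \<Rightarrow> bool" where
  "koszul_exact N f \<longleftrightarrow> (\<forall>u\<in>formal_tensors N. bdry f u \<in> tensor_relations N \<longrightarrow>
     (\<exists>v\<in>formal_tensors N. bdry f v - u \<in> tensor_relations N))"

definition map_slots :: "('e::complex_banach op \<Rightarrow> 'e op) \<Rightarrow> 'e formal \<Rightarrow> 'e formal" where
  "map_slots p = linear_extension (\<lambda>(e, ys). symb e (map p ys))"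

text \<open>Contraction with the functional \<open>\<phi>\<close> followed by \<^term>\<open>map_slots p\<close>.\<close>

fun contract_symb ::
    "('e::complex_banach op \<Rightarrow> complex) \<Rightarrow> ('e op \<Rightarrow> 'e op) \<Rightarrow> 'e \<Rightarrow> 'e op list \<Rightarrow> 'e formal" where
  "contract_symb \<phi> p e [] = 0"
| "contract_symb \<phi> p e (z # ys) =
     \<phi> z *\<^sub>C symb e (map p ys) - wedge (p z) (contract_symb \<phi> p e ys)"

definition contract ::
    "('e::complex_banach op \<Rightarrow> complex) \<Rightarrow> ('e op \<Rightarrow> 'e op) \<Rightarrow> 'e formal \<Rightarrow> 'e formal" where
  "contract \<phi> p = linear_extension (\<lambda>(e, ys). contract_symb \<phi> p e ys)"

lemma map_slots_linear [simp]:
  "map_slots p (u + v) = map_slots p u + map_slots p v"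
  "map_slots p (u - v) = map_slots p u - map_slots p v"
  "map_slots p (a *\<^sub>C u) = a *\<^sub>C map_slots p u"
  "map_slots p 0 = 0"
  by (simp_all add: map_slots_def)

lemma contract_linear [simp]:
  "contract \<phi> p (u + v) = contract \<phi> p u + contract \<phi> p v"
  "contract \<phi> p (u - v) = contract \<phi> p u - contract \<phi> p v"
  "contract \<phi> p (a *\<^sub>C u) = a *\<^sub>C contract \<phi> p u"
  "contract \<phi> p 0 = 0"
  by (simp_all add: contract_def)

lemma map_slots_symb [simp]: "map_slots p (symb e ys) = symb e (map p ys)"
  by (simp add: map_slots_def)

lemma contract_symb_Nil [simp]: "contract \<phi> p (symb e []) = 0"
  by (simp add: contract_def)

lemma map_slots_wedge [simp]: "map_slots p (wedge z u) = wedge (p z) (map_slots p u)"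
  using formal_tensors_UNIV[of u] by (induction rule: formal_tensors_symb_induct) auto

lemma contract_wedge [simp]:
  "contract \<phi> p (wedge z u) = \<phi> z *\<^sub>C map_slots p u - wedge (p z) (contract \<phi> p u)"
  using formal_tensors_UNIV[of u]
proof (induction rule: formal_tensors_symb_induct)
  case (add u v)
  then show ?case by (simp add: add complex_vector.scale_right_distrib)
next
  case (scale a u)
  then show ?case by (simp add: scale complex_vector.scale_right_diff_distrib mult.commute)
next
  case (symb e ys)
  then show ?case by (simp add: contract_def)
qed auto

text \<open>\<open>N\<close> is the direct sum of the ideal \<open>M\<close> and the line through
  \<open>x\<close>, with \<phi> the coordinate along \<open>x\<close>. Being an ideal,
  \<open>M\<close> has its formal tensors preserved by \<open>act f x\<close>.\<close>

locale lie_extension = lie_character N f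
  for N :: "'e::complex_banach op set" and f +
  fixes M :: "'e op set" and x :: "'e op" and \<phi> :: "'e op \<Rightarrow> complex"
  assumes M_subspace: "csubspace M" and M_subset: "M \<subseteq> N"
    and M_ideal: "\<And>y z. y \<in> N \<Longrightarrow> z \<in> M \<Longrightarrow> bracket y z \<in> M"
    and x_in [simp]: "x \<in> N"
    and \<phi>_add: "\<And>y z. y \<in> N \<Longrightarrow> z \<in> N \<Longrightarrow> \<phi> (y + z) = \<phi> y + \<phi> z"
    and \<phi>_scale: "\<And>a y. y \<in> N \<Longrightarrow> \<phi> (a *\<^sub>C y) = a * \<phi> y"
    and \<phi>_x [simp]: "\<phi> x = 1"
    and \<phi>_M: "\<And>y. y \<in> M \<Longrightarrow> \<phi> y = 0"
    and \<phi>_split: "\<And>y. y \<in> N \<Longrightarrow> y - \<phi> y *\<^sub>C x \<in> M"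
begin

definition "proj z = z - \<phi> z *\<^sub>C x"

abbreviation "RM \<equiv> tensor_relations M"
abbreviation "FM \<equiv> formal_tensors M"
abbreviation "pr \<equiv> map_slots proj"
abbreviation "ct \<equiv> contract \<phi> proj"

lemma proj_in [simp]: "z \<in> N \<Longrightarrow> proj z \<in> M"
  by (simp add: proj_def \<phi>_split)

lemma proj_add: "y \<in> N \<Longrightarrow> z \<in> N \<Longrightarrow> proj (y + z) = proj y + proj z"
  by (simp add: proj_def \<phi>_add complex_vector.scale_left_distrib)

lemma proj_scale: "y \<in> N \<Longrightarrow> proj (a *\<^sub>C y) = a *\<^sub>C proj y"
  by (simp add: proj_def \<phi>_scale complex_vector.scale_right_diff_distrib)

lemma proj_x [simp]: "proj x = 0"
  by (simp add: proj_def complex_vector.scale_one)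

lemma proj_M: "y \<in> M \<Longrightarrow> proj y = y"
  by (simp add: proj_def \<phi>_M)

lemma M_in_N [simp]: "y \<in> M \<Longrightarrow> y \<in> N"
  using M_subset by blast

lemma FM_in_F [simp]: "u \<in> FM \<Longrightarrow> u \<in> F"
  using formal_tensors_mono[OF M_subset] by blast

lemma RM_in_R [simp]: "u \<in> RM \<Longrightarrow> u \<in> R"
  using relations_mono[OF M_subset] by blast

lemma zero_in_M [simp]: "0 \<in> M"
  by (rule complex_vector.subspace_0[OF M_subspace])

lemma pr_in_FM [simp]: "u \<in> F \<Longrightarrow> pr u \<in> FM"
  by (induction rule: formal_tensors_induct) auto

lemma ct_in_FM [simp]: "u \<in> F \<Longrightarrow> ct u \<in> FM"
  by (induction rule: formal_tensors_induct) auto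

lemma act_in_FM [simp]: "u \<in> FM \<Longrightarrow> y \<in> N \<Longrightarrow> act f y u \<in> FM"
  by (induction rule: formal_tensors_induct) (auto simp: act_symb_Nil act_wedge M_ideal)

sublocale M: lie_character M f
  using M_subspace M_subset complex_ops
  by unfold_locales (auto simp: M_ideal f_add f_scale f_bracket)

section \<open>The decomposition of the exterior algebra by projection and contraction\<close>

lemma pr_relations:
  assumes "u \<in> R"
  shows "pr u \<in> RM"
  using assms subspace
proof (induction rule: relations_induct)
  case (e_add e e')
  then show ?case using relation_add[of "[]"] by simp
next
  case (e_scale a e)
  then show ?case using relation_scale[of "[]"] by simp
qed (auto simp: proj_add proj_scale intro: relation_wedge_add relation_wedge_scale
    relation_wedge_self relation_wedge)

text \<open>Contraction is an antiderivation twisted by \<open>proj\<close>. On a square of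
  \<open>y\<close> the two terms with \<open>\<phi> y\<close> cancel, and a square of
  \<open>proj y\<close> remains.\<close>

lemma ct_relations:
  assumes "u \<in> R"
  shows "ct u \<in> RM"
  using assms subspace
proof (induction rule: relations_induct)
  case (slot_add y y' u)
  have "ct (wedge (y + y') u - wedge y u - wedge y' u)
    = - (wedge (proj y + proj y') (ct u) - wedge (proj y) (ct u) - wedge (proj y') (ct u))"
    using slot_add by (simp add: \<phi>_add proj_add complex_vector.scale_left_distrib algebra_simps)
  also have "\<dots> \<in> RM"
    using slot_add by (intro relations_closed(4) relation_wedge_add) auto
  finally show ?case .
next
  case (slot_scale a y u)
  have "ct (wedge (a *\<^sub>C y) u - a *\<^sub>C wedge y u)
    = - (wedge (a *\<^sub>C proj y) (ct u) - a *\<^sub>C wedge (proj y) (ct u))"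
    using slot_scale
    by (simp add: \<phi>_scale proj_scale complex_vector.scale_right_diff_distrib algebra_simps)
  also have "\<dots> \<in> RM"
    using slot_scale by (intro relations_closed(4) relation_wedge_scale) auto
  finally show ?case .
next
  case (self y u)
  then show ?case by (simp add: relation_wedge_self)
next
  case (wedge z u)
  then show ?case
    by (auto intro!: relations_closed(3,5) relation_wedge pr_relations)
qed auto

lemma pr_FM: "u \<in> FM \<Longrightarrow> pr u = u"
  by (induction rule: formal_tensors_induct) (auto simp: proj_M)

lemma ct_FM: "u \<in> FM \<Longrightarrow> ct u = 0"
  by (induction rule: formal_tensors_induct) (auto simp: \<phi>_M)

text \<open>The larger space imposes no new relations on tensors over \<open>M\<close>, because
  \<open>pr\<close> fixes them and maps relations over \<open>N\<close> to relations over
  \<open>M\<close>.\<close>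

lemma R_FM: "u \<in> R \<Longrightarrow> u \<in> FM \<Longrightarrow> u \<in> RM"
  using pr_relations[of u] pr_FM[of u] by simp

text \<open>The head entry \<open>z\<close> is \<open>proj z\<close> plus a multiple of
  \<open>x\<close>. After expansion \<open>x\<close> is moved to the front past
  \<open>proj z\<close>, and terms containing \<open>x\<close> twice vanish.\<close>

lemma split:
  assumes "u \<in> F"
  shows "u - (pr u + wedge x (ct u)) \<in> R"
  using assms
proof (induction rule: formal_tensors_induct)
  case (add u v)
  then show ?case using relations_closed(2)[OF add] by (simp add: algebra_simps)
next
  case (scale a u)
  then show ?case using relations_closed(5)[OF scale, of a]
    by (simp add: complex_vector.scale_right_diff_distrib complex_vector.scale_right_distrib)
next
  case (wedge z u)
  let ?p = "proj z" and ?a = "\<phi> z"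
  have z: "?p + ?a *\<^sub>C x = z" by (simp add: proj_def)
  have "wedge z u - (pr (wedge z u) + wedge x (ct (wedge z u)))
    = (wedge (?p + ?a *\<^sub>C x) u - wedge ?p u - wedge (?a *\<^sub>C x) u)
      + (wedge (?a *\<^sub>C x) u - ?a *\<^sub>C wedge x u)
      + wedge ?p (u - (pr u + wedge x (ct u)))
      + ?a *\<^sub>C (wedge x (u - (pr u + wedge x (ct u))) + wedge x (wedge x (ct u)))
      + (wedge ?p (wedge x (ct u)) + wedge x (wedge ?p (ct u)))"
    unfolding z by (simp add: algebra_simps complex_vector.scale_right_diff_distrib
      complex_vector.scale_right_distrib)
  also have "\<dots> \<in> R"
    using wedge subspace
    by (intro relations_closed(2)[OF relations_closed(2)[OF relations_closed(2)[OF relations_closed(2)]]]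
      relations_closed(5) relation_wedge_add relation_wedge_scale relation_wedge relation_wedge_swap
      relations_closed(2)[OF relation_wedge relation_wedge_self] wedge.IH) auto
  finally show ?case .
qed auto

text \<open>Apply \<open>pr\<close>, which replaces \<open>x\<close> by 0, and \<open>ct\<close>,
  which extracts \<open>b\<close>.\<close>

lemma split_unique:
  assumes "a \<in> FM" "b \<in> FM" "a + wedge x b \<in> R"
  shows "a \<in> RM" "b \<in> RM"
proof -
  have "a + wedge 0 b \<in> RM"
    using pr_relations[OF assms(3)] assms by (simp add: pr_FM)
  then show "a \<in> RM"
    using relations_closed(3)[OF _ relation_wedge_zero[OF assms(2)]] by fastforce
  have "b \<in> R"
    using ct_relations[OF assms(3)] assms by (simp add: ct_FM pr_FM complex_vector.scale_one)
  then show "b \<in> RM" using assms by (simp add: R_FM)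
qed

text \<open>The cycle equations of the mapping cone: by \<open>bdry_wedge\<close> the two
  expressions are, up to sign, the components of \<open>bdry f u\<close> in the splitting, and the
  splitting is unique.\<close>

lemma cycle_parts:
  assumes u: "u \<in> F" "bdry f u \<in> R"
  shows "bdry f (pr u) + act f x (ct u) \<in> RM" "bdry f (ct u) \<in> RM"
proof -
  let ?a = "pr u" and ?b = "ct u"
  let ?r = "bdry f (wedge x ?b) - (act f x ?b - wedge x (bdry f ?b))"
  have "(bdry f ?a + act f x ?b) + wedge x (- bdry f ?b)
      = bdry f u - bdry f (u - (?a + wedge x ?b)) - ?r"
    by (simp add: algebra_simps)
  also have "\<dots> \<in> R"
    using u
    by (intro relations_closed(3)[OF relations_closed(3)[OF u(2) bdry_relations[OF split]]] bdry_wedge)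
       auto
  finally have *: "(bdry f ?a + act f x ?b) + wedge x (- bdry f ?b) \<in> R" .
  have "bdry f ?a + act f x ?b \<in> FM" "- bdry f ?b \<in> FM"
    using u by (auto intro!: formal_tensors_closed)
  from split_unique[OF this *] show "bdry f ?a + act f x ?b \<in> RM" "bdry f ?b \<in> RM"
    using relations_closed(4)[of "- bdry f ?b" M] by auto
qed

text \<open>A primitive \<open>b'\<close> of \<open>ct u\<close> turns
  \<open>pr u + act f x b'\<close> into a cycle over \<open>M\<close>. With a primitive
  \<open>a'\<close> of that cycle, \<open>a' - wedge x b'\<close> bounds \<open>u\<close>.\<close>

lemma exact_of_exact:
  assumes "koszul_exact M f"
  shows "koszul_exact N f"
  unfolding koszul_exact_def
proof (intro ballI impI)
  fix u assume u: "u \<in> F" "bdry f u \<in> R"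
  let ?a = "pr u" and ?b = "ct u"
  note parts = cycle_parts[OF u]
  obtain b' where b': "b' \<in> FM" "bdry f b' - ?b \<in> RM"
    using assms parts(2) u unfolding koszul_exact_def by auto
  let ?a' = "?a + act f x b'"
  have "bdry f ?a' = (bdry f ?a + act f x ?b) + act f x (bdry f b' - ?b)
      - (act f x (bdry f b') - bdry f (act f x b'))"
    by simp
  also have "\<dots> \<in> R"
    using b' parts
    by (intro relations_closed(3)[OF relations_closed(2)] act_relations act_bdry_commute) auto
  finally have "bdry f ?a' \<in> RM"
    using u b' by (intro R_FM) auto
  moreover have "?a' \<in> FM" using u b' by simp
  ultimately obtain a' where a': "a' \<in> FM" "bdry f a' - ?a' \<in> RM"
    using assms unfolding koszul_exact_def by blast
  let ?r = "bdry f (wedge x b') - (act f x b' - wedge x (bdry f b'))"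
  have "bdry f (a' - wedge x b') - u
      = (bdry f a' - ?a') - ?r + wedge x (bdry f b' - ?b) - (u - (?a + wedge x ?b))"
    by (simp add: algebra_simps)
  also have "\<dots> \<in> R"
    using a' b' u
    by (intro relations_closed(3)[OF relations_closed(2)[OF relations_closed(3)]] bdry_wedge split
        relation_wedge) auto
  finally show "\<exists>v\<in>F. bdry f v - u \<in> R"
    using a' b' by (intro bexI[of _ "a' - wedge x b'"]) auto
qed

text \<open>Solve \<open>act f x c = pr u\<close> modulo the relations. The cycle equations show
  that \<open>act f x\<close> kills \<open>ct u + bdry f c\<close>, hence by injectivity this is
  zero and \<open>wedge x c\<close> bounds \<open>u\<close>.\<close>

lemma exact_of_bijective:
  assumes surj: "\<And>b. b \<in> FM \<Longrightarrow> \<exists>c\<in>FM. act f x c - b \<in> RM"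
    and inj: "\<And>c. c \<in> FM \<Longrightarrow> act f x c \<in> RM \<Longrightarrow> c \<in> RM"
  shows "koszul_exact N f"
  unfolding koszul_exact_def
proof (intro ballI impI)
  fix u assume u: "u \<in> F" "bdry f u \<in> R"
  let ?a = "pr u" and ?b = "ct u"
  note parts = cycle_parts[OF u]
  obtain c where c: "c \<in> FM" "act f x c - ?a \<in> RM"
    using surj[of ?a] u by auto
  let ?d = "?b + bdry f c"
  have "act f x ?d = (bdry f ?a + act f x ?b) + (act f x (bdry f c) - bdry f (act f x c))
      + bdry f (act f x c - ?a)"
    by simp
  also have "\<dots> \<in> R"
    using c parts
    by (intro relations_closed(2)[OF relations_closed(2)] bdry_relations act_bdry_commute) auto
  finally have "act f x ?d \<in> R" .
  moreover have d: "?d \<in> FM" using u c by simp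
  moreover have "act f x ?d \<in> FM" using d x_in by (rule act_in_FM)
  ultimately have "?d \<in> RM" by (blast intro: inj R_FM)
  let ?r = "bdry f (wedge x c) - (act f x c - wedge x (bdry f c))"
  have "bdry f (wedge x c) - u
      = ?r + (act f x c - ?a) - wedge x ?d + - (u - (?a + wedge x ?b))"
    by (simp add: algebra_simps)
  also have "\<dots> \<in> R"
    using c u \<open>?d \<in> RM\<close>
    by (intro relations_closed(2)[OF relations_closed(3)[OF relations_closed(2)]]
        relations_closed(4) bdry_wedge split relation_wedge) auto
  finally show "\<exists>v\<in>F. bdry f v - u \<in> R"
    using c by (intro bexI[of _ "wedge x c"]) auto
qed

end


section \<open>Degrees and cosets\<close>

text \<open>\<open>koszul_exact\<close> yields a primitive of no particular degree, whereas
  \<open>homology_nonzero\<close> is graded; this projection onto one degree mediates.\<close>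

definition degree_part :: "nat \<Rightarrow> 'e::complex_banach formal \<Rightarrow> 'e formal" where
  "degree_part q = linear_extension (\<lambda>(e, ys). if length ys = q then symb e ys else 0)"

lemma degree_part_linear [simp]:
  "degree_part q (u + v) = degree_part q u + degree_part q v"
  "degree_part q (u - v) = degree_part q u - degree_part q v"
  "degree_part q (a *\<^sub>C u) = a *\<^sub>C degree_part q u"
  "degree_part q (- u) = - degree_part q u"
  "degree_part q (sum h A) = (\<Sum>i\<in>A. degree_part q (h i))"
  "degree_part q 0 = 0"
  by (simp_all add: degree_part_def)

lemma degree_part_symb [simp]:
  "degree_part q (symb e ys) = (if length ys = q then symb e ys else 0)"
  by (simp add: degree_part_def)

lemma degree_part_wedge:
  "degree_part q (wedge z u) = (case q of 0 \<Rightarrow> 0 | Suc r \<Rightarrow> wedge z (degree_part r u))"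
  using formal_tensors_UNIV[of u]
  by (induction rule: formal_tensors_symb_induct) (auto split: nat.split)

lemma degree_part_relations:
  assumes "u \<in> tensor_relations N" and N: "csubspace N"
  shows "degree_part q u \<in> tensor_relations N"
proof -
  have [simp]: "degree_part r u \<in> formal_tensors N" if "u \<in> formal_tensors N" for r u
    using that by (induction rule: formal_tensors_symb_induct) auto
  show ?thesis
    using assms
  proof (induction arbitrary: q rule: relations_induct)
    case (e_add e e')
    then show ?case by (auto intro: relation_add)
  next
    case (e_scale a e)
    then show ?case by (auto intro: relation_scale)
  qed (auto simp: degree_part_wedge split: nat.split intro: relation_wedge_add
      relation_wedge_scale relation_wedge_self relation_wedge)
qed

lemma degree_part_in_deg:
  assumes "u \<in> formal_tensors N"
  shows "degree_part q u \<in> formal_tensors_deg N q"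
  using assms unfolding formal_tensors_deg_def
  by (induction rule: formal_tensors_symb_induct)
     (auto intro: complex_vector.span_zero complex_vector.span_add complex_vector.span_scale
       complex_vector.span_base)

lemma degree_part_eq:
  assumes "u \<in> formal_tensors_deg N q"
  shows "degree_part q u = u"
  using assms unfolding formal_tensors_deg_def
  by (rule complex_vector.span_induct) (auto intro!: complex_vector.subspaceI)

lemma formal_tensors_deg_subset: "formal_tensors_deg N q \<subseteq> formal_tensors N"
  unfolding formal_tensors_deg_def formal_tensors_def by (rule complex_vector.span_mono) blast

text \<open>Each term of the boundary has one entry less: either one is deleted, or two are deleted
  and their bracket is put in.\<close>

lemma degree_part_bdry: "degree_part q (bdry f u) = bdry f (degree_part (Suc q) u)"
  using formal_tensors_UNIV[of u]
proof (induction rule: formal_tensors_symb_induct)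
  case (symb e ys)
  have "length (nths ys (- {k})) = length ys - 1" if "k < length ys" for k
  proof -
    have "{i. i < length ys \<and> i \<in> - {k}} = {..<length ys} - {k}" by auto
    then show ?thesis using that by (simp add: length_nths)
  qed
  moreover have "length (nths ys (- {k, l})) = length ys - 2" if "l < length ys" "k < l" for k l
  proof -
    have "{i. i < length ys \<and> i \<in> - {k, l}} = {..<length ys} - {k, l}" by auto
    then show ?thesis using that by (simp add: length_nths card_Diff_subset)
  qed
  ultimately have len: "k < length ys \<Longrightarrow> length (nths ys (- {k})) = q \<longleftrightarrow> length ys = Suc q"
      "l < length ys \<Longrightarrow> k < l \<Longrightarrow> Suc (length (nths ys (- {k, l}))) = q \<longleftrightarrow> length ys = Suc q"
    for k l
    by auto
  have "degree_part q (boundary_symb f (e, ys))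
      = (if length ys = Suc q then boundary_symb f (e, ys) else 0)"
    by (simp add: boundary_symb_def len cong: sum.cong_simp if_cong)
  then show ?case by (simp add: bdry_def)
qed auto

section \<open>From representatives to cosets: homology and spectrum\<close>

lemma relations_coset_eq_iff:
  "u +o tensor_relations N = v +o tensor_relations N \<longleftrightarrow> u - v \<in> tensor_relations N"
proof
  assume "u +o tensor_relations N = v +o tensor_relations N"
  moreover have "u \<in> u +o tensor_relations N" by (simp add: elt_set_plus_def)
  ultimately show "u - v \<in> tensor_relations N" by (auto simp: elt_set_plus_def)
next
  have *: "u +o tensor_relations N \<subseteq> v +o tensor_relations N"
    if "u - v \<in> tensor_relations N" for u v
  proof
    fix w assume "w \<in> u +o tensor_relations N"
    then obtain r where "r \<in> tensor_relations N" "w = u + r" by (auto simp: elt_set_plus_def)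
    then have "w = v + ((u - v) + r)" "(u - v) + r \<in> tensor_relations N"
      using that by auto
    then show "w \<in> v +o tensor_relations N" unfolding elt_set_plus_def by blast
  qed
  assume r: "u - v \<in> tensor_relations N"
  then have "v - u \<in> tensor_relations N" using relations_closed(4) by fastforce
  with r show "u +o tensor_relations N = v +o tensor_relations N" using * by blast
qed

lemma induced_map_coset:
  assumes "\<And>u v. G (u + v) = G u + G v" "\<And>u. u \<in> tensor_relations N \<Longrightarrow> G u \<in> tensor_relations N"
  shows "induced_map N G (u +o tensor_relations N) = G u +o tensor_relations N"
proof -
  have "G v +o tensor_relations N = G u +o tensor_relations N" if "v \<in> u +o tensor_relations N" for v
    using that assms by (auto simp: elt_set_plus_def[of u] relations_coset_eq_iff)
  moreover have "u \<in> u +o tensor_relations N" by (simp add: elt_set_plus_def)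
  ultimately show ?thesis unfolding induced_map_def by blast
qed

lemma relations_coset_eq_zero_iff:
  "u +o tensor_relations N = tensor_relations N \<longleftrightarrow> u \<in> tensor_relations N"
  using relations_coset_eq_iff[of u N 0] by simp

lemma (in lie_character) boundary_coset: "boundary N f (u +o R) = bdry f u +o R"
  unfolding boundary_def bdry_def[symmetric]
  by (rule induced_map_coset) (auto intro: bdry_relations)

text \<open>For a cycle of degree \<open>p\<close>, the component of degree \<open>p + 1\<close> of
  any primitive is again a primitive, as the relations are homogeneous.\<close>

lemma (in lie_character) homology_zero:
  assumes "koszul_exact N f"
  shows "\<not> homology_nonzero N f p"
proof
  assume "homology_nonzero N f p"
  then obtain u where u: "u \<in> formal_tensors_deg N p" "boundary N f (u +o R) = R"
      "u +o R \<notin> boundary N f ` tensor_ext_deg N (Suc p)"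
    unfolding homology_nonzero_def tensor_ext_deg_def by blast
  then have "u \<in> F" "bdry f u \<in> R"
    using formal_tensors_deg_subset by (auto simp: boundary_coset relations_coset_eq_zero_iff)
  then obtain v where v: "v \<in> F" "bdry f v - u \<in> R"
    using assms unfolding koszul_exact_def by blast
  let ?v = "degree_part (Suc p) v"
  have "bdry f ?v - u \<in> R"
    using degree_part_relations[OF v(2) subspace, of p] u(1)
    by (simp add: degree_part_bdry degree_part_eq)
  then have "boundary N f (?v +o R) = u +o R"
    by (simp add: boundary_coset relations_coset_eq_iff)
  moreover have "?v +o R \<in> tensor_ext_deg N (Suc p)"
    unfolding tensor_ext_deg_def using degree_part_in_deg[OF v(1)] by blast
  ultimately show False using u(3) by (metis image_eqI)
qed

text \<open>Since \<open>x\<close> lies outside \<open>M\<close>, the invariance is taken from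
  \<open>N\<close> and brought back to \<open>M\<close> by \<open>R_FM\<close>.\<close>

lemma (in lie_extension) act_relations_M: "u \<in> RM \<Longrightarrow> act f x u \<in> RM"
proof -
  assume u: "u \<in> RM"
  then have "u \<in> FM"
    using M_subspace by (induction rule: relations_induct) auto
  with u show ?thesis by (intro R_FM act_relations) auto
qed

lemma (in lie_extension) exact_of_not_in_spectrum:
  assumes "f x \<notin> xbar_spectrum M x"
  shows "koszul_exact N f"
proof (rule exact_of_bijective)
  have bij: "bij_betw (xbar_minus M x (f x)) (tensor_ext M) (tensor_ext M)"
    using assms unfolding xbar_spectrum_def by blast
  have coset: "xbar_minus M x (f x) (u +o RM) = act f x u +o RM" for u
    unfolding xbar_minus_def act_def[symmetric]
    by (rule induced_map_coset) (auto intro: act_relations_M)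
  show "\<exists>c\<in>FM. act f x c - b \<in> RM" if "b \<in> FM" for b
  proof -
    have "b +o RM \<in> xbar_minus M x (f x) ` tensor_ext M"
      using that bij unfolding bij_betw_def by (auto simp: tensor_ext_def)
    then obtain c where "c \<in> FM" "b +o RM = xbar_minus M x (f x) (c +o RM)"
      unfolding tensor_ext_def by blast
    then show ?thesis by (metis coset relations_coset_eq_iff)
  qed
  show "c \<in> RM" if "c \<in> FM" "act f x c \<in> RM" for c
  proof -
    have "xbar_minus M x (f x) (c +o RM) = xbar_minus M x (f x) (0 +o RM)"
      unfolding coset relations_coset_eq_iff using that by simp
    moreover have "c +o RM \<in> tensor_ext M" "0 +o RM \<in> tensor_ext M"
      using that formal_tensors_closed(1) unfolding tensor_ext_def by blast+
    ultimately have "c +o RM = 0 +o RM"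
      using bij unfolding bij_betw_def by (meson inj_onD)
    then show ?thesis by (simp only: relations_coset_eq_iff diff_zero)
  qed
qed


section \<open>The spectral inclusion\<close>

text \<open>This supplies the \<phi> of \<open>lie_extension\<close>, as the coefficient of
  \<open>v\<close> in the basis representation. Linearity is claimed on the span only, because the
  representation is zero by convention outside it.\<close>

lemma coordinate_functional:
  assumes ind: "cindependent (insert v B)" and v: "v \<notin> B"
  shows "\<exists>\<phi>. \<phi> v = 1 \<and> (\<forall>y\<in>cspan B. \<phi> y = 0) \<and>
    (\<forall>y\<in>cspan (insert v B). \<forall>z\<in>cspan (insert v B). \<phi> (y + z) = \<phi> y + \<phi> z) \<and>
    (\<forall>a. \<forall>y\<in>cspan (insert v B). \<phi> (a *\<^sub>C y) = a * \<phi> y) \<and>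
    (\<forall>y\<in>cspan (insert v B). y - \<phi> y *\<^sub>C v \<in> cspan B)"
proof -
  define \<phi> where "\<phi> y = complex_vector.representation (insert v B) y v" for y
  have \<phi>_v: "\<phi> v = 1"
    using ind by (simp add: \<phi>_def complex_vector.representation_basis)
  have add: "\<phi> (y + z) = \<phi> y + \<phi> z" if "y \<in> cspan (insert v B)" "z \<in> cspan (insert v B)" for y z
    using ind that by (simp add: \<phi>_def complex_vector.representation_add)
  have scale: "\<phi> (a *\<^sub>C y) = a * \<phi> y" if "y \<in> cspan (insert v B)" for a y
    using ind that by (simp add: \<phi>_def complex_vector.representation_scale)
  have zero: "\<phi> y = 0" if "y \<in> cspan B" for y
  proof -
    have "complex_vector.representation (insert v B) y = complex_vector.representation B y"
      by (rule complex_vector.representation_extend[OF ind that]) blast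
    then show ?thesis
      using complex_vector.representation_ne_zero[of B y v] v unfolding \<phi>_def by auto
  qed
  have "y - \<phi> y *\<^sub>C v \<in> cspan B" if "y \<in> cspan (insert v B)" for y
  proof -
    \<comment> \<open>Some coefficient \<open>k\<close> exists by the description of the span;
      evaluating \<phi> identifies it with \<open>\<phi> y\<close>.\<close>
    obtain k where k: "y - k *\<^sub>C v \<in> cspan B"
      using \<open>y \<in> cspan (insert v B)\<close> by (auto simp: complex_vector.span_breakdown_eq)
    have v_in: "v \<in> cspan (insert v B)" by (rule complex_vector.span_base) simp
    have "y - k *\<^sub>C v \<in> cspan (insert v B)"
      using k complex_vector.span_mono[of B "insert v B"] by blast
    moreover have "k *\<^sub>C v \<in> cspan (insert v B)"
      using v_in by (rule complex_vector.span_scale)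
    ultimately have "\<phi> ((y - k *\<^sub>C v) + k *\<^sub>C v) = \<phi> (y - k *\<^sub>C v) + \<phi> (k *\<^sub>C v)"
      by (rule add)
    then have "\<phi> y = k"
      using zero[OF k] scale[OF v_in, of k] \<phi>_v by simp
    then show ?thesis using k by simp
  qed
  with \<phi>_v zero add scale show ?thesis by blast
qed

theorem theorem3p2:
  fixes L :: "('e::complex_banach \<Rightarrow>\<^sub>L 'e) set"
    and n :: nat
    and Ls :: "nat \<Rightarrow> ('e \<Rightarrow>\<^sub>L 'e) set"
    and x :: "nat \<Rightarrow> 'e \<Rightarrow>\<^sub>L 'e"
  assumes "lie_subalgebra L"
    and "finite_dimensional L" and "cdim L = n"
    and "lie_solvable L"
    and "jordan_hoelder_sequence L n Ls"
    and "jordan_hoelder_basis n Ls x"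
  shows "(\<lambda>f. \<lambda>j\<in>{1..n}. f (x j)) ` joint_spectrum L
           \<subseteq> (\<Pi>\<^sub>E j\<in>{1..n}. xbar_spectrum (Ls (j - 1)) (x j))"
proof -
  have L: "L \<subseteq> bounded_complex_operators" "csubspace L"
      "\<And>y z. y \<in> L \<Longrightarrow> z \<in> L \<Longrightarrow> bracket y z \<in> L"
    using assms(1) unfolding lie_subalgebra_def by auto
  have ideal: "Ls i \<subseteq> L" "csubspace (Ls i)" "\<And>y z. y \<in> L \<Longrightarrow> z \<in> Ls i \<Longrightarrow> bracket y z \<in> Ls i"
    if "i \<le> n" for i
    using assms(5) that unfolding jordan_hoelder_sequence_def lie_ideal_def by auto
  have Ls_n: "Ls n = L"
    using assms(5) unfolding jordan_hoelder_sequence_def by auto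
  have mono: "Ls i \<subseteq> Ls (Suc i)" if "i < n" for i
    using assms(5) that unfolding jordan_hoelder_sequence_def by auto
  have basis: "cindependent (x ` {1..i})" "cspan (x ` {1..i}) = Ls i" if "i \<le> n" for i
    using assms(6) that unfolding jordan_hoelder_basis_def by auto
  have inj: "inj_on x {1..n}"
    using assms(6) unfolding jordan_hoelder_basis_def by auto
  have "f (x j) \<in> xbar_spectrum (Ls (j - 1)) (x j)"
    if f: "f \<in> joint_spectrum L" and j: "j \<in> {1..n}" for f j
  proof (rule ccontr)
    assume not_in: "f (x j) \<notin> xbar_spectrum (Ls (j - 1)) (x j)"
    have f_lin: "\<And>y z. y \<in> L \<Longrightarrow> z \<in> L \<Longrightarrow> f (y + z) = f y + f z"
        "\<And>a y. y \<in> L \<Longrightarrow> f (a *\<^sub>C y) = a * f y"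
      using f unfolding joint_spectrum_def dual_space_def by auto
    have f_bracket: "f (bracket y z) = 0" if "y \<in> L" "z \<in> L" for y z
    proof -
      have "bracket y z \<in> derived_algebra L"
        unfolding derived_algebra_def using that by (intro complex_vector.span_base) blast
      then show ?thesis using f unfolding joint_spectrum_def by auto
    qed
    have character: "lie_character (Ls i) f" if "i \<le> n" for i
    proof
      show "csubspace (Ls i)" "Ls i \<subseteq> bounded_complex_operators"
        using ideal[OF that] L by auto
    next
      fix a y z assume "y \<in> Ls i" "z \<in> Ls i"
      moreover from this have "y \<in> L" "z \<in> L" using ideal[OF that] by auto
      ultimately show "bracket y z \<in> Ls i" "f (y + z) = f y + f z" "f (bracket y z) = 0"
        using ideal[OF that] by (auto simp: f_lin f_bracket)
    next
      show "f (a *\<^sub>C y) = a * f y" if "y \<in> Ls i" for a y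
        using that ideal[OF \<open>i \<le> n\<close>] by (auto simp: f_lin)
    qed
    have extension: "\<exists>\<phi>. lie_extension (Ls (Suc i)) f (Ls i) (x (Suc i)) \<phi>" if i: "i < n" for i
    proof -
      have not_in: "x (Suc i) \<notin> x ` {1..i}"
      proof
        assume "x (Suc i) \<in> x ` {1..i}"
        then obtain k where k: "k \<in> {1..i}" "x (Suc i) = x k" by blast
        have "Suc i = k" by (rule inj_onD[OF inj k(2)]) (use k(1) i in auto)
        then show False using k(1) by simp
      qed
      have "x ` {1..Suc i} = insert (x (Suc i)) (x ` {1..i})"
        by (auto simp: atLeastAtMostSuc_conv)
      then have "cindependent (insert (x (Suc i)) (x ` {1..i}))"
        and spans: "cspan (insert (x (Suc i)) (x ` {1..i})) = Ls (Suc i)"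
          "cspan (x ` {1..i}) = Ls i"
        using basis[of "Suc i"] basis[of i] i by auto
      from coordinate_functional[OF this(1) not_in, unfolded spans] obtain \<phi>
        where \<phi>: "\<phi> (x (Suc i)) = 1" "\<And>y. y \<in> Ls i \<Longrightarrow> \<phi> y = 0"
          "\<And>y z. y \<in> Ls (Suc i) \<Longrightarrow> z \<in> Ls (Suc i) \<Longrightarrow> \<phi> (y + z) = \<phi> y + \<phi> z"
          "\<And>a y. y \<in> Ls (Suc i) \<Longrightarrow> \<phi> (a *\<^sub>C y) = a * \<phi> y"
          "\<And>y. y \<in> Ls (Suc i) \<Longrightarrow> y - \<phi> y *\<^sub>C x (Suc i) \<in> Ls i"
        by blast
      have x_in: "x (Suc i) \<in> Ls (Suc i)"
        unfolding spans(1)[symmetric] by (rule complex_vector.span_base) simp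
      have br: "bracket y z \<in> Ls i" if "y \<in> Ls (Suc i)" "z \<in> Ls i" for y z
        using that ideal(1)[of "Suc i"] ideal(3)[of i] i by auto
      have "lie_extension (Ls (Suc i)) f (Ls i) (x (Suc i)) \<phi>"
        using i character[of "Suc i"] ideal(2)[of i] mono[OF i] x_in br \<phi>
        by (intro lie_extension.intro lie_extension_axioms.intro) simp_all
      then show ?thesis by blast
    qed
    have "j \<le> n" using j by simp
    \<comment> \<open>Induction upwards from \<open>j\<close>: exactness begins at
      \<open>Ls j\<close>, obtained by adjoining \<open>x j\<close> to \<open>Ls (j - 1)\<close>,
      and is inherited at each further extension.\<close>
    then have "koszul_exact (Ls n) f"
    proof (induction rule: dec_induct)
      case base
      \<comment> \<open>Since \<open>j\<close> is at least 1, the subtraction in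
        \<open>Ls (j - 1)\<close> is not truncated and the ideal is \<open>Ls i\<close>.\<close>
      obtain i where i: "j = Suc i" "i < n" using j by (cases j) auto
      obtain \<phi> where "lie_extension (Ls (Suc i)) f (Ls i) (x (Suc i)) \<phi>"
        using extension[OF i(2)] ..
      then show ?case using lie_extension.exact_of_not_in_spectrum not_in i by fastforce
    next
      case (step i)
      obtain \<phi> where "lie_extension (Ls (Suc i)) f (Ls i) (x (Suc i)) \<phi>"
        using extension[OF step(2)] ..
      then show ?case using step.IH by (rule lie_extension.exact_of_exact)
    qed
    then show False
      using lie_character.homology_zero[OF character[of n]] f Ls_n unfolding joint_spectrum_def by auto
  qed
  then show ?thesis by auto
qed

end
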